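(* Suppose that $f:\mathbb{R}^d\to\mathbb{R}$ is convex and twice continuously differentiable with a minimizer $x^*$, and that $f$ satisfies either the global or the local generalized Hessian smoothness condition (with constants $M_0,M_1\ge0$, and radius $\rho>0$ in the local case). Let $R=\|x_0-x^*\|$. All backtracking loops in the fully adaptive accelerated cubic regularization method, started from $x_0$ with input $\tilde{\mathcal M}_0>0$, terminate. For every $\varepsilon>0$, under the global condition, the method returns an iterate $w_N$ satisfying $f(w_N)-f^*\le\varepsilon$ for $$N=\mathcal{O}\Big(\Big(\frac{M_0R^3}{\varepsilon}\Big)^{1/3}\Big)+\widetilde{\mathcal O}\big(1+\sqrt{M_1}R\big).$$ Under the local condition, the corresponding bound is $$N=\mathcal{O}\Big(\Big(\frac{M_0R^3}{\varepsilon}\Big)^{1/3}\Big)+\widetilde{\mathcal O}\Big(1+\sqrt{M_1}R+\frac R\rho\Big).$$ The number of rejected initialization trials is at most $\left\lceil\log_2\max\{1,T_0/\tilde{\mathcal M}_0\}\right\rceil$, where $T_0=M_0+2M_1\|\nabla f(x_0)\|$ under the global condition and $T_0=\max\big\{M_0+2M_1\|\nabla f(x_0)\|,\ \frac{2\|\nabla f(x_0)\|}{15\rho^2}\big\}$ under the local condition. Before returning $w_N$, the main backtracking loops reject at most $$\left\lceil\log_2\max\Big\{1,\ B,\ \frac{4M_0R^3}{3\varepsilon}\Big\}\right\rceil$$ trials in total, where $B=12\sqrt2\,M_1^{3/2}R^3$ under the global condition and $B=\max\big\{12\sqrt2\,M_1^{3/2}R^3,\ \frac{2R^3}{9\rho^3}\big\}$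 under the local condition.
   Context: $\|\cdot\|$ is the Euclidean norm for vectors and the induced operator norm for matrices; $f^*=f(x^* )$. Put $L(x)=M_0+M_1\|\nabla f(x)\|$. Global generalized Hessian smoothness: $\|\nabla^2f(y)-\nabla^2f(x)\|\le L(x)\|y-x\|$ for all $x,y\in\mathbb{R}^d$. Local generalized Hessian smoothness with radius $\rho>0$: the same inequality for all $x,y$ with $\|y-x\|\le\rho$. $\widetilde{\mathcal O}$ hides logarithmic factors. Fully adaptive accelerated cubic regularization method (exact Hessians). Input $x_0\in\mathbb{R}^d$, $\tilde{\mathcal M}_0>0$. If $\nabla f(x_0)=0$, return $x_0$ (no trials are made). Initialization: with $\tilde{\mathcal M}=\tilde{\mathcal M}_0$ compute $$\tilde s=\arg\min_{s\in\mathbb{R}^d}\Big\{\langle\nabla f(x_0),s\rangle+\tfrac12\langle\nabla^2f(x_0)s,s\rangle+\tfrac{15\tilde{\mathcal M}}{6}\|s\|^3\Big\},\quad\tilde x=x_0+\tilde s;$$ while $\langle\nabla f(\tilde x),-\tilde s\rangle\ge\frac{2}{9\sqrt{\tilde{\mathcal M}}}\|\nabla f(\tilde x)\|^{3/2}$ does not hold (a rejected initialization trial), double $\tilde{\mathcal M}$ and recompute $\tilde s,\tilde x$. Set $\Gamma_0=\frac{3\|\nabla f(x_0)\|^3}{(f(x_0)-f(\tilde x))^2}$, $A_0=1$, $w_0=z_0=x_0$, $\psi_0(x)=f(x_0)+\frac{\Gamma_0}3\|x-x_0\|^3$, $\mathcal M_0=\Gamma_0$ (the regularization coefficients $\mathcal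 M_k$ are distinct from the smoothness constants $M_0,M_1$). For $k\ge0$: with the current $\mathcal M_k$, let $\alpha_k\in(0,1)$ be the unique solution of $\frac{\alpha_k^3}{1-\alpha_k}=\frac{\Gamma_k}{72\mathcal M_k}$; set $A_{k+1}=\frac{A_k}{1-\alpha_k}$, $a_{k+1}=\alpha_kA_{k+1}$, $\Gamma_{k+1}=(1-\alpha_k)\Gamma_k$, $v_k=(1-\alpha_k)w_k+\alpha_kz_k$, and $$s_k=\arg\min_{s\in\mathbb{R}^d}\Big\{\langle\nabla f(v_k),s\rangle+\tfrac12\langle\nabla^2f(v_k)s,s\rangle+\tfrac{15\mathcal M_k}{6}\|s\|^3\Big\},\quad w_{k+1}=v_k+s_k.$$ While $\langle\nabla f(w_{k+1}),v_k-w_{k+1}\rangle\ge\frac{2}{9\sqrt{\mathcal M_k}}\|\nabla f(w_{k+1})\|^{3/2}$ does not hold (a rejected main trial), double $\mathcal M_k$ and recompute all these quantities. After acceptance set $\psi_{k+1}(x)=\psi_k(x)+a_{k+1}\big(f(w_{k+1})+\langle\nabla f(w_{k+1}),x-w_{k+1}\rangle\big)$, $z_{k+1}=\arg\min_{x\in\mathbb{R}^d}\psi_{k+1}(x)$, and start iteration $k+1$ with $\mathcal M_{k+1}=\frac{\Gamma_{k+1}}{\Gamma_k}\mathcal M_k$. *)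

theory Defs
  imports "HOL-Analysis.Analysis"
begin

text \<open>
  Throughout, \<open>g\<close> and \<open>H\<close> stand for the gradient and the Hessian of \<open>f\<close>. The Hessian is a bounded
  linear map, so \<open>norm (H y - H x)\<close> is the operator norm induced by the Euclidean norm.
\<close>

definition global_gen_smooth ::
    "('a::euclidean_space \<Rightarrow> 'a) \<Rightarrow> ('a \<Rightarrow> 'a \<Rightarrow>\<^sub>L 'a) \<Rightarrow> real \<Rightarrow> real \<Rightarrow> bool" where
  "global_gen_smooth g H M0 M1 \<longleftrightarrow>
     (\<forall>x y. norm (H y - H x) \<le> (M0 + M1 * norm (g x)) * norm (y - x))"

definition local_gen_smooth ::
    "('a::euclidean_space \<Rightarrow> 'a) \<Rightarrow> ('a \<Rightarrow> 'a \<Rightarrow>\<^sub>L 'a) \<Rightarrow> real \<Rightarrow> real \<Rightarrow> real \<Rightarrow> bool" where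
  "local_gen_smooth g H M0 M1 \<rho> \<longleftrightarrow>
     (\<forall>x y. norm (y - x) \<le> \<rho> \<longrightarrow> norm (H y - H x) \<le> (M0 + M1 * norm (g x)) * norm (y - x))"

definition cubic_step ::
    "('a::euclidean_space \<Rightarrow> 'a) \<Rightarrow> ('a \<Rightarrow> 'a \<Rightarrow>\<^sub>L 'a) \<Rightarrow> real \<Rightarrow> 'a \<Rightarrow> 'a" where
  "cubic_step g H M v =
     arg_min (\<lambda>s. g v \<bullet> s + 1/2 * (H v s \<bullet> s) + 15 * M / 6 * norm s ^ 3) (\<lambda>_. True)"

definition accepted :: "('a::euclidean_space \<Rightarrow> 'a) \<Rightarrow> real \<Rightarrow> 'a \<Rightarrow> 'a \<Rightarrow> bool" where
  "accepted g M v w \<longleftrightarrow> g w \<bullet> (v - w) \<ge> 2 / (9 * sqrt M) * norm (g w) powr (3/2)"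

text \<open>
  A backtracking loop started at \<open>M\<close> tries the coefficients \<open>M, 2 M, 4 M, \<dots>\<close>; trial number \<open>i\<close>
  uses \<open>2 ^ i * M\<close>. If the loop terminates, the number of rejected trials is the least accepted \<open>i\<close>;
  otherwise that number (a \<open>LEAST\<close> over the empty set) is meaningless, so termination has to be
  claimed separately, see \<open>loops_terminate\<close> below.
\<close>

definition init_point ::
    "('a::euclidean_space \<Rightarrow> 'a) \<Rightarrow> ('a \<Rightarrow> 'a \<Rightarrow>\<^sub>L 'a) \<Rightarrow> 'a \<Rightarrow> real \<Rightarrow> 'a" where
  "init_point g H x0 M = x0 + cubic_step g H M x0"

definition init_ok ::
    "('a::euclidean_space \<Rightarrow> 'a) \<Rightarrow> ('a \<Rightarrow> 'a \<Rightarrow>\<^sub>L 'a) \<Rightarrow> 'a \<Rightarrow> real \<Rightarrow> nat \<Rightarrow> bool" where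
  "init_ok g H x0 Mt0 i \<longleftrightarrow> accepted g (2 ^ i * Mt0) x0 (init_point g H x0 (2 ^ i * Mt0))"

definition init_rejections ::
    "('a::euclidean_space \<Rightarrow> 'a) \<Rightarrow> ('a \<Rightarrow> 'a \<Rightarrow>\<^sub>L 'a) \<Rightarrow> 'a \<Rightarrow> real \<Rightarrow> nat" where
  "init_rejections g H x0 Mt0 = (if g x0 = 0 then 0 else (LEAST i. init_ok g H x0 Mt0 i))"

definition Gamma0 ::
    "('a::euclidean_space \<Rightarrow> real) \<Rightarrow> ('a \<Rightarrow> 'a) \<Rightarrow> ('a \<Rightarrow> 'a \<Rightarrow>\<^sub>L 'a) \<Rightarrow> 'a \<Rightarrow> real \<Rightarrow> real" where
  "Gamma0 f g H x0 Mt0 =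
     3 * norm (g x0) ^ 3 /
       (f x0 - f (init_point g H x0 (2 ^ init_rejections g H x0 Mt0 * Mt0)))\<^sup>2"

text \<open>
  The data with which an iteration starts. \<open>reg_st\<close> is the regularization coefficient before any
  doubling in that iteration.
\<close>

record 'a acr_data =
  w_st :: 'a
  z_st :: 'a
  A_st :: real
  Gamma_st :: real
  reg_st :: real
  psi_st :: "'a \<Rightarrow> real"

definition init_state ::
    "('a::euclidean_space \<Rightarrow> real) \<Rightarrow> ('a \<Rightarrow> 'a) \<Rightarrow> ('a \<Rightarrow> 'a \<Rightarrow>\<^sub>L 'a) \<Rightarrow> 'a \<Rightarrow> real
      \<Rightarrow> 'a acr_data" where
  "init_state f g H x0 Mt0 =
     (let \<Gamma> = Gamma0 f g H x0 Mt0 in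
      \<lparr> w_st = x0, z_st = x0, A_st = 1, Gamma_st = \<Gamma>, reg_st = \<Gamma>,
        psi_st = (\<lambda>x. f x0 + \<Gamma> / 3 * norm (x - x0) ^ 3) \<rparr>)"

definition trial_alpha :: "'a acr_data \<Rightarrow> real \<Rightarrow> real" where
  "trial_alpha st M =
     (THE \<alpha>. 0 < \<alpha> \<and> \<alpha> < 1 \<and> \<alpha> ^ 3 / (1 - \<alpha>) = Gamma_st st / (72 * M))"

definition trial_v :: "('a::euclidean_space) acr_data \<Rightarrow> real \<Rightarrow> 'a" where
  "trial_v st M = (1 - trial_alpha st M) *\<^sub>R w_st st + trial_alpha st M *\<^sub>R z_st st"

definition trial_w ::
    "('a::euclidean_space \<Rightarrow> 'a) \<Rightarrow> ('a \<Rightarrow> 'a \<Rightarrow>\<^sub>L 'a) \<Rightarrow> 'a acr_data \<Rightarrow> real \<Rightarrow> 'a" where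
  "trial_w g H st M = trial_v st M + cubic_step g H M (trial_v st M)"

definition main_ok ::
    "('a::euclidean_space \<Rightarrow> 'a) \<Rightarrow> ('a \<Rightarrow> 'a \<Rightarrow>\<^sub>L 'a) \<Rightarrow> 'a acr_data \<Rightarrow> nat \<Rightarrow> bool" where
  "main_ok g H st i \<longleftrightarrow>
     (let M = 2 ^ i * reg_st st in accepted g M (trial_v st M) (trial_w g H st M))"

definition main_rejections ::
    "('a::euclidean_space \<Rightarrow> 'a) \<Rightarrow> ('a \<Rightarrow> 'a \<Rightarrow>\<^sub>L 'a) \<Rightarrow> 'a acr_data \<Rightarrow> nat" where
  "main_rejections g H st = (LEAST i. main_ok g H st i)"

definition next_state ::
    "('a::euclidean_space \<Rightarrow> real) \<Rightarrow> ('a \<Rightarrow> 'a) \<Rightarrow> ('a \<Rightarrow> 'a \<Rightarrow>\<^sub>L 'a) \<Rightarrow> 'a acr_data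
      \<Rightarrow> 'a acr_data" where
  "next_state f g H st =
     (let M = 2 ^ main_rejections g H st * reg_st st;
          \<alpha> = trial_alpha st M;
          A' = A_st st / (1 - \<alpha>);
          a' = \<alpha> * A';
          \<Gamma>' = (1 - \<alpha>) * Gamma_st st;
          w' = trial_w g H st M;
          \<psi>' = (\<lambda>x. psi_st st x + a' * (f w' + g w' \<bullet> (x - w')))
      in \<lparr> w_st = w', z_st = arg_min \<psi>' (\<lambda>_. True), A_st = A', Gamma_st = \<Gamma>',
           reg_st = \<Gamma>' / Gamma_st st * M, psi_st = \<psi>' \<rparr>)"

text \<open>
  State at the start of iteration \<open>k\<close>. If \<open>g x0 = 0\<close>, the method returns \<open>x0\<close> at once and only
  \<open>w_st\<close> of the state with index 0 is meaningful.
\<close>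

primrec acr_state ::
    "('a::euclidean_space \<Rightarrow> real) \<Rightarrow> ('a \<Rightarrow> 'a) \<Rightarrow> ('a \<Rightarrow> 'a \<Rightarrow>\<^sub>L 'a) \<Rightarrow> 'a \<Rightarrow> real \<Rightarrow> nat
      \<Rightarrow> 'a acr_data" where
  "acr_state f g H x0 Mt0 0 = init_state f g H x0 Mt0"
| "acr_state f g H x0 Mt0 (Suc k) = next_state f g H (acr_state f g H x0 Mt0 k)"

definition acr_iterate ::
    "('a::euclidean_space \<Rightarrow> real) \<Rightarrow> ('a \<Rightarrow> 'a) \<Rightarrow> ('a \<Rightarrow> 'a \<Rightarrow>\<^sub>L 'a) \<Rightarrow> 'a \<Rightarrow> real \<Rightarrow> nat
      \<Rightarrow> 'a" where
  "acr_iterate f g H x0 Mt0 k = w_st (acr_state f g H x0 Mt0 k)"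

definition loops_terminate ::
    "('a::euclidean_space \<Rightarrow> real) \<Rightarrow> ('a \<Rightarrow> 'a) \<Rightarrow> ('a \<Rightarrow> 'a \<Rightarrow>\<^sub>L 'a) \<Rightarrow> 'a \<Rightarrow> real
      \<Rightarrow> bool" where
  "loops_terminate f g H x0 Mt0 \<longleftrightarrow>
     (g x0 \<noteq> 0 \<longrightarrow>
        (\<exists>i. init_ok g H x0 Mt0 i) \<and>
        (\<forall>k. \<exists>i. main_ok g H (acr_state f g H x0 Mt0 k) i))"

definition total_main_rejections ::
    "('a::euclidean_space \<Rightarrow> real) \<Rightarrow> ('a \<Rightarrow> 'a) \<Rightarrow> ('a \<Rightarrow> 'a \<Rightarrow>\<^sub>L 'a) \<Rightarrow> 'a \<Rightarrow> real \<Rightarrow> nat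
      \<Rightarrow> nat" where
  "total_main_rejections f g H x0 Mt0 N =
     (\<Sum>k<N. main_rejections g H (acr_state f g H x0 Mt0 k))"

text \<open>
  The method reaches accuracy \<open>\<epsilon>\<close> at iteration \<open>N\<close>: \<open>w\<^sub>N\<close> is the first iterate whose objective gap is
  at most \<open>\<epsilon>\<close>.
\<close>

definition returns_at ::
    "('a::euclidean_space \<Rightarrow> real) \<Rightarrow> ('a \<Rightarrow> 'a) \<Rightarrow> ('a \<Rightarrow> 'a \<Rightarrow>\<^sub>L 'a) \<Rightarrow> 'a \<Rightarrow> real \<Rightarrow> real \<Rightarrow> real
      \<Rightarrow> nat \<Rightarrow> bool" where
  "returns_at f g H x0 Mt0 fstar \<epsilon> N \<longleftrightarrow>
     f (acr_iterate f g H x0 Mt0 N) - fstar \<le> \<epsilon> \<and>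
     (\<forall>k<N. f (acr_iterate f g H x0 Mt0 k) - fstar > \<epsilon>)"

text \<open>
  The constant behind \<open>O\<close> is absolute; in particular it does not depend on the dimension. As the
  space is a type, an existential quantifier inside a theorem would let the constant vary with the
  dimension, hence the explicit (not optimized) value.
\<close>

definition big_O_const :: real where
  "big_O_const = 1000"

text \<open>
  The factor hidden by the soft-\<open>O\<close>: a single logarithm of a sum of scale-invariant combinations of
  the problem data and the input \<open>Mt0\<close>. The argument \<open>G\<close> is \<open>norm (g x0)\<close>, and \<open>\<tau>\<close> is \<open>R / \<rho>\<close> under the
  local condition and \<open>0\<close> under the global one.
\<close>

definition log_factor ::
    "real \<Rightarrow> real \<Rightarrow> real \<Rightarrow> real \<Rightarrow> real \<Rightarrow> real \<Rightarrow> real \<Rightarrow> real" where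
  "log_factor M0 M1 Mt0 R G \<epsilon> \<tau> =
     ln (2 + M0 * R ^ 3 / \<epsilon> + M1 * R\<^sup>2 + Mt0 * R ^ 3 / \<epsilon> + G * R / \<epsilon> + G / (Mt0 * R\<^sup>2) + \<tau>)"

end

theory Submission
  imports Defs
begin

text \<open>
  Write \<open>L v = M0 + M1 * norm (g v)\<close>. The obstacle is that the gradient at the extrapolated point \<open>v\<close>, and
  with it the smoothness constant \<open>L v\<close>, may be arbitrarily large: the estimate sequence bounds neither
  \<open>g v\<close> nor \<open>f v\<close>. Three ideas get around it.

  First, the Taylor error of a step \<open>s\<close> from \<open>v\<close> is estimated with the constant \<open>L (v + s)\<close> at
  the end of the step (\<open>taylor_center_end\<close>). For steps of length at most \<open>b\<close>, with \<open>M1 * b\<^sup>2\<close> small,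
  the gradient contained in \<open>L (v + s)\<close> can be absorbed, and the trial passes the test once \<open>M\<close> dominates \<open>M0\<close>.

  Second, longer steps do not occur for large \<open>M\<close>. The point \<open>v\<close> is close to the convex combination
  \<open>y\<close> of the iterate \<open>w\<close> and \<open>xstar\<close> with the weights that form \<open>v\<close> from \<open>w\<close> and \<open>z\<close>; the
  optimality gap of \<open>y\<close> is small. If the cubic step were longer than \<open>b\<close>, then the step to the minimizer of the quadratic model on a ball of radius \<open>b\<close> would end
  at a point whose large gradient points back to \<open>v\<close>, and convexity would force \<open>f y\<close> to exceed the
  minimum by more than its gap (\<open>accepted_if_near_almost_optimal\<close>). Fed with the estimate sequence
  (\<open>invariant_step\<close>, \<open>invariant_gap\<close>), this yields the acceptance threshold of \<open>main_accepted\<close>: the gap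
  of \<open>w\<close> is at most \<open>2/3 * \<Gamma> * R ^ 3\<close>, and a trial is accepted as soon as \<open>M\<close> is at least \<open>B * \<Gamma>\<close> and
  at least a multiple of \<open>M0\<close>.

  Third, \<open>M / \<Gamma>\<close> is exactly the power of two whose exponent is the number of rejections so far (\<open>reg_eq\<close>), so the
  threshold gives the bound on the rejections, and also the size of \<open>\<alpha>\<close>. Depending on which part of
  the threshold dominates, an iteration either shrinks \<open>\<Gamma>\<close> by a fixed factor or increases
  \<open>\<Gamma> powr (-1/3)\<close> by a fixed amount, if not more; a potential that adds up both effects gives the number of
  iterations (\<open>potential_increase\<close>, \<open>iteration_bound\<close>), the logarithm being that of \<open>\<Gamma>0 * R ^ 3 / \<epsilon>\<close>
  (\<open>\<Gamma>0_bound\<close>).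

  All of this is done under the local condition. The global one is the local one for all radii, and the
  bounds survive the limit (\<open>iteration_bound_limit\<close>).
\<close>

section \<open>Convex functions with a continuous Hessian\<close>

text \<open>
  The deviation of the increment from \<open>c\<close> is at most the integral of \<open>K * t\<close> over the unit interval.
  Applied to a gradient along a segment, this is the Taylor estimate of order two.
\<close>
lemma fst_order_expansion_bound:
  fixes \<gamma> :: "real \<Rightarrow> 'b::real_normed_vector"
  assumes deriv: "\<And>t. (\<gamma> has_vector_derivative \<gamma>' t) (at t)"
    and lip: "\<And>t. 0 < t \<Longrightarrow> t < 1 \<Longrightarrow> norm (\<gamma>' t - c) \<le> K * t"
  shows "norm (\<gamma> 1 - \<gamma> 0 - c) \<le> K / 2"
proof -
  have d: "((\<lambda>t. \<gamma> t - t *\<^sub>R c) has_vector_derivative (\<gamma>' t - c)) (at t)" for t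
    by (auto intro!: derivative_eq_intros deriv)
  have dphi: "((\<lambda>t. K / 2 * t\<^sup>2) has_vector_derivative (K * t)) (at t)" for t :: real
    unfolding has_real_derivative_iff_has_vector_derivative[symmetric]
    by (auto intro!: derivative_eq_intros)
  have "norm ((\<gamma> 1 - 1 *\<^sub>R c) - (\<gamma> 0 - 0 *\<^sub>R c)) \<le> K / 2 * 1\<^sup>2 - K / 2 * 0\<^sup>2"
    by (rule differentiable_bound_general[where f' = "\<lambda>t. \<gamma>' t - c" and \<phi>' = "\<lambda>t. K * t"])
      (use d dphi lip in \<open>auto intro!: continuous_at_imp_continuous_on
         has_vector_derivative_continuous\<close>)
  then show ?thesis by (simp add: algebra_simps)
qed

locale convex_C2 =
  fixes f :: "'a::euclidean_space \<Rightarrow> real" and g :: "'a \<Rightarrow> 'a" and H :: "'a \<Rightarrow> 'a \<Rightarrow>\<^sub>L 'a"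
  assumes convex: "convex_on UNIV f"
    and gradient: "\<And>x. GDERIV f x :> g x"
    and hessian: "\<And>x. (g has_derivative blinfun_apply (H x)) (at x)"
    and hessian_cont: "continuous_on UNIV H"
begin

lemma f_line_deriv: "((\<lambda>t. f (x + t *\<^sub>R u)) has_real_derivative g (x + t *\<^sub>R u) \<bullet> u) (at t)"
proof -
  have "((\<lambda>t. x + t *\<^sub>R u) has_derivative (\<lambda>h. h *\<^sub>R u)) (at t)"
    by (auto intro!: derivative_eq_intros)
  from has_derivative_compose[OF this gradient[unfolded gderiv_def]]
  show ?thesis
    by (simp add: has_field_derivative_def inner_commute mult.commute[of "u \<bullet> _"] mult_commute_abs)
qed

lemma g_line_deriv: "((\<lambda>t. g (x + t *\<^sub>R u)) has_vector_derivative H (x + t *\<^sub>R u) u) (at t)"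
proof -
  have "((\<lambda>t. x + t *\<^sub>R u) has_derivative (\<lambda>h. h *\<^sub>R u)) (at t)"
    by (auto intro!: derivative_eq_intros)
  from has_derivative_compose[OF this hessian]
  show ?thesis
    by (simp add: has_vector_derivative_def blinfun.scaleR_right)
qed

lemma g_inner_line_deriv:
  "((\<lambda>t. g (x + t *\<^sub>R u) \<bullet> w) has_real_derivative H (x + t *\<^sub>R u) u \<bullet> w) (at t)"
  using has_derivative_inner_left[OF g_line_deriv[unfolded has_vector_derivative_def], of x u w t]
  by (simp add: has_field_derivative_def mult_commute_abs)

lemma gradient_ineq: "f x + g x \<bullet> (y - x) \<le> f y"
proof -
  let ?\<phi> = "\<lambda>t::real. f (x + t *\<^sub>R (y - x))"
  have c: "convex_on UNIV ?\<phi>"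
  proof (rule convex_onI)
    fix t a b :: real assume t: "0 < t" "t < 1"
    have "x + ((1 - t) *\<^sub>R a + t *\<^sub>R b) *\<^sub>R (y - x)
        = (1 - t) *\<^sub>R (x + a *\<^sub>R (y - x)) + t *\<^sub>R (x + b *\<^sub>R (y - x))"
      by (simp add: algebra_simps)
    then show "?\<phi> ((1 - t) *\<^sub>R a + t *\<^sub>R b) \<le> (1 - t) * ?\<phi> a + t * ?\<phi> b"
      using convex_onD[OF convex, of t] t by simp
  qed simp
  have "?\<phi> 1 - ?\<phi> 0 \<ge> (g (x + 0 *\<^sub>R (y - x)) \<bullet> (y - x)) * (1 - 0)"
    by (rule convex_on_imp_above_tangent[OF c]) (use f_line_deriv[of x "y - x" 0] in auto)
  then show ?thesis by simp
qed

lemma gradient_mono: "0 \<le> (g y - g x) \<bullet> (y - x)"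
  using gradient_ineq[of x y] gradient_ineq[of y x] by (simp add: algebra_simps)

lemma hessian_psd: "0 \<le> H x u \<bullet> u"
proof (rule mono_on_imp_deriv_nonneg)
  show "mono_on UNIV (\<lambda>t. g (x + t *\<^sub>R u) \<bullet> u)"
  proof (rule mono_onI)
    fix a b :: real assume "a \<le> b"
    have "0 \<le> (b - a) * ((g (x + b *\<^sub>R u) - g (x + a *\<^sub>R u)) \<bullet> u)"
      using gradient_mono[of "x + b *\<^sub>R u" "x + a *\<^sub>R u"]
      by (simp flip: scaleR_left_diff_distrib)
    with \<open>a \<le> b\<close> show "g (x + a *\<^sub>R u) \<bullet> u \<le> g (x + b *\<^sub>R u) \<bullet> u"
      by (cases "a = b") (auto simp: zero_le_mult_iff inner_diff_left)
  qed
  show "((\<lambda>t. g (x + t *\<^sub>R u) \<bullet> u) has_real_derivative H x u \<bullet> u) (at 0)"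
    using g_inner_line_deriv[of x u u 0] by simp
qed simp

text \<open>
  The left-hand side is symmetric in \<open>u\<close> and \<open>v\<close>, which is what makes the Hessian symmetric in the
  limit \<open>t \<rightarrow> 0\<close>. Two applications of the mean value theorem, first in direction \<open>u\<close>, then in \<open>v\<close>.
\<close>
lemma mixed_difference:
  assumes "0 < t"
  shows "\<exists>a b. 0 < a \<and> a < t \<and> 0 < b \<and> b < t \<and>
    f (x + t *\<^sub>R u + t *\<^sub>R v) - f (x + t *\<^sub>R u) - f (x + t *\<^sub>R v) + f x
      = t * t * (H (x + a *\<^sub>R u + b *\<^sub>R v) v \<bullet> u)"
proof -
  let ?\<phi> = "\<lambda>a. f ((x + t *\<^sub>R v) + a *\<^sub>R u) - f (x + a *\<^sub>R u)"
  have "\<exists>a>0. a < t \<and> ?\<phi> t - ?\<phi> 0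
      = (t - 0) * (g ((x + t *\<^sub>R v) + a *\<^sub>R u) \<bullet> u - g (x + a *\<^sub>R u) \<bullet> u)"
    by (rule MVT2) (auto intro!: DERIV_diff f_line_deriv assms)
  then obtain a where a: "0 < a" "a < t" "?\<phi> t - ?\<phi> 0
      = (t - 0) * (g ((x + t *\<^sub>R v) + a *\<^sub>R u) \<bullet> u - g (x + a *\<^sub>R u) \<bullet> u)" by blast
  have "\<exists>b>0. b < t \<and> g ((x + a *\<^sub>R u) + t *\<^sub>R v) \<bullet> u - g ((x + a *\<^sub>R u) + 0 *\<^sub>R v) \<bullet> u
      = (t - 0) * (H ((x + a *\<^sub>R u) + b *\<^sub>R v) v \<bullet> u)"
    by (rule MVT2) (auto intro!: g_inner_line_deriv assms)
  then obtain b where b: "0 < b" "b < t"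
    "g ((x + a *\<^sub>R u) + t *\<^sub>R v) \<bullet> u - g ((x + a *\<^sub>R u) + 0 *\<^sub>R v) \<bullet> u
      = (t - 0) * (H ((x + a *\<^sub>R u) + b *\<^sub>R v) v \<bullet> u)" by blast
  show ?thesis
    by (intro exI[of _ a] exI[of _ b]) (use a b in \<open>simp add: algebra_simps\<close>)
qed

text \<open>
  Symmetry matters because the cubic model contains the Hessian only as a quadratic form, so that
  minimizing it gives an equation for the symmetric part, whereas the Taylor expansion of the gradient
  involves the Hessian itself.
\<close>
lemma hessian_sym: "H x u \<bullet> v = H x v \<bullet> u"
proof -
  \<comment> \<open>Both mixed differences equal the same second difference of \<open>f\<close>, and \<open>H\<close> is nearly constant close to \<open>x\<close>.\<close>
  have "\<bar>H x v \<bullet> u - H x u \<bullet> v\<bar> \<le> e" if "e > 0" for e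
  proof -
    define e' where "e' = e / (2 * (norm u * norm v + 1))"
    have e': "e' > 0" using that by (simp add: e'_def add_nonneg_pos)
    obtain d where d: "d > 0" "\<And>y. dist y x < d \<Longrightarrow> dist (H y) (H x) < e'"
      using hessian_cont e' unfolding continuous_on_iff by (metis UNIV_I)
    define t where "t = d / (norm u + norm v + 1)"
    have pos: "norm u + norm v + 1 > 0" by (simp add: add_nonneg_pos)
    then have t: "0 < t" using d by (simp add: t_def)
    have td: "t * (norm u + norm v) < d" using d pos by (simp add: t_def field_simps)
    have close: "\<bar>H (x + (a *\<^sub>R u + b *\<^sub>R v)) p \<bullet> q - H x p \<bullet> q\<bar> \<le> e' * (norm p * norm q)"
      if "0 < a" "a < t" "0 < b" "b < t" for a b p q
    proof -
      have "norm (a *\<^sub>R u + b *\<^sub>R v) \<le> a * norm u + b * norm v"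
        using norm_triangle_ineq[of "a *\<^sub>R u" "b *\<^sub>R v"] that by simp
      also have "\<dots> \<le> t * norm u + t * norm v"
        using that by (intro add_mono mult_right_mono) auto
      finally have "dist (x + (a *\<^sub>R u + b *\<^sub>R v)) x < d"
        using td by (simp add: dist_norm algebra_simps)
      then have n: "norm (H (x + (a *\<^sub>R u + b *\<^sub>R v)) - H x) \<le> e'"
        using d(2) unfolding dist_norm by (meson less_imp_le)
      have "\<bar>(H (x + (a *\<^sub>R u + b *\<^sub>R v)) - H x) p \<bullet> q\<bar>
          \<le> norm (H (x + (a *\<^sub>R u + b *\<^sub>R v)) - H x) * norm p * norm q"
        by (meson Cauchy_Schwarz_ineq2 mult_right_mono norm_blinfun norm_ge_zero order_trans)
      also have "\<dots> \<le> e' * norm p * norm q"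
        using n by (intro mult_right_mono) auto
      finally show ?thesis by (simp add: blinfun.diff_left inner_diff_left mult.assoc)
    qed
    obtain a b where ab: "0 < a" "a < t" "0 < b" "b < t"
      "f (x + t *\<^sub>R u + t *\<^sub>R v) - f (x + t *\<^sub>R u) - f (x + t *\<^sub>R v) + f x
        = t * t * (H (x + a *\<^sub>R u + b *\<^sub>R v) v \<bullet> u)"
      using mixed_difference[OF t, of x u v] by blast
    obtain a' b' where ab': "0 < a'" "a' < t" "0 < b'" "b' < t"
      "f (x + t *\<^sub>R v + t *\<^sub>R u) - f (x + t *\<^sub>R v) - f (x + t *\<^sub>R u) + f x
        = t * t * (H (x + a' *\<^sub>R v + b' *\<^sub>R u) u \<bullet> v)"
      using mixed_difference[OF t, of x v u] by blast
    have "t * t * (H (x + a *\<^sub>R u + b *\<^sub>R v) v \<bullet> u) = t * t * (H (x + a' *\<^sub>R v + b' *\<^sub>R u) u \<bullet> v)"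
      using ab(5) ab'(5) by (simp add: algebra_simps)
    then have eq: "H (x + (a *\<^sub>R u + b *\<^sub>R v)) v \<bullet> u = H (x + (b' *\<^sub>R u + a' *\<^sub>R v)) u \<bullet> v"
      using t by (simp add: algebra_simps)
    have "\<bar>H x v \<bullet> u - H x u \<bullet> v\<bar> \<le> 2 * e' * (norm u * norm v)"
      using close[OF ab(1-4), of v u] close[OF ab'(3,4,1,2), of u v] eq
      by (simp add: algebra_simps abs_le_iff)
    also have "\<dots> \<le> e"
    proof -
      have p: "norm u * norm v + 1 > 0" by (simp add: add_nonneg_pos)
      have "2 * e' * (norm u * norm v) \<le> 2 * e' * (norm u * norm v + 1)"
        using e' by (intro mult_left_mono) auto
      also have "\<dots> = e" using p unfolding e'_def by (simp add: divide_simps)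
      finally show ?thesis .
    qed
    finally show ?thesis .
  qed
  then have "\<bar>H x v \<bullet> u - H x u \<bullet> v\<bar> \<le> 0" by (rule field_le_epsilon) simp
  then show ?thesis by simp
qed

lemma taylor_center_start:
  assumes "\<And>z. norm (z - v) \<le> norm s \<Longrightarrow> norm (H z - H v) \<le> L * norm (z - v)" 
  shows "norm (g (v + s) - g v - H v s) \<le> L / 2 * (norm s)\<^sup>2"
proof -
  have "norm (g (v + 1 *\<^sub>R s) - g (v + 0 *\<^sub>R s) - H v s) \<le> (L * (norm s)\<^sup>2) / 2"
  proof (rule fst_order_expansion_bound[OF g_line_deriv])
    fix t :: real assume t: "0 < t" "t < 1"
    have "norm (H (v + t *\<^sub>R s) s - H v s) \<le> norm (H (v + t *\<^sub>R s) - H v) * norm s"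
      by (metis blinfun.diff_left norm_blinfun)
    also have "\<dots> \<le> (L * (t * norm s)) * norm s"
      using assms[of "v + t *\<^sub>R s"] t by (intro mult_right_mono) (auto simp: mult_left_le_one_le)
    finally show "norm (H (v + t *\<^sub>R s) s - H v s) \<le> L * (norm s)\<^sup>2 * t"
      by (simp add: power2_eq_square algebra_simps)
  qed
  then show ?thesis by simp
qed

text \<open>
  The Hessian is compared with its value at the end point of the step. Generalized smoothness then
  costs a factor \<open>M0 + M1 * norm (g (v + s))\<close>, in which the gradient at \<open>v\<close>, over which there is no
  control, does not appear.
\<close>
lemma taylor_center_end:
  assumes "\<And>z. norm (z - (v + s)) \<le> norm s \<Longrightarrow> norm (H z - H (v + s)) \<le> L * norm (z - (v + s))" 
  shows "norm (g (v + s) - g v - H v s) \<le> 3 / 2 * L * (norm s)\<^sup>2"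
proof -
  let ?w = "v + s"
  have 1: "norm (g (?w + - s) - g ?w - H ?w (- s)) \<le> L / 2 * (norm (- s))\<^sup>2"
    by (rule taylor_center_start) (use assms in auto)
  have 2: "norm ((H v - H ?w) s) \<le> L * norm s * norm s"
    using assms[of v] by (intro order_trans[OF norm_blinfun] mult_right_mono) auto
  have "g (v + s) - g v - H v s = - (g (?w + - s) - g ?w - H ?w (- s)) - (H v - H ?w) s"
    by (simp add: blinfun.minus_right blinfun.diff_left)
  then have "norm (g (v + s) - g v - H v s)
      \<le> norm (g (?w + - s) - g ?w - H ?w (- s)) + norm ((H v - H ?w) s)"
    by (metis norm_minus_cancel norm_triangle_ineq4)
  with 1 2 show ?thesis by (simp add: power2_eq_square algebra_simps)
qed

end

section \<open>Cubic and trust-region models\<close>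

lemma norm_cube_has_derivative:
  fixes x :: "'a::real_inner"
  shows "((\<lambda>x. norm x ^ 3) has_derivative (\<lambda>h. 3 * norm x * (x \<bullet> h))) (at x)"
proof (cases "x = 0")
  case True
  have "(\<lambda>y. norm (norm y ^ 3 - norm x ^ 3 - 3 * norm x * (x \<bullet> (y - x))) / norm (y - x))
      = (\<lambda>y. (norm y)\<^sup>2)"
    using True by (auto simp: fun_eq_iff power2_eq_square power3_eq_cube)
  moreover have "((\<lambda>y::'a. (norm y)\<^sup>2) \<longlongrightarrow> (norm x)\<^sup>2) (at x)"
    by (intro tendsto_intros)
  ultimately show ?thesis using True
    unfolding has_derivative_iff_norm by simp
next
  case False
  then show ?thesis
    by (auto intro!: derivative_eq_intros has_derivative_norm ext
        simp: sgn_div_norm inner_commute power2_eq_square)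
qed

text \<open>
  With \<open>a\<close>, \<open>b\<close>, \<open>d\<close> the norms of \<open>z\<close>, \<open>x\<close> and \<open>x - z\<close>, the claim becomes the polynomial inequality
  \<open>0 \<le> (b - a)\<^sup>2 * (2 * b + a) + d\<^sup>2 * (3 * a - d)\<close>. It is obvious unless \<open>d > 3 * a\<close>, and then the
  triangle inequality \<open>d \<le> a + b\<close> reduces it to its value at \<open>d = a + b\<close>.
\<close>
lemma norm_cube_uniformly_convex:
  fixes x z :: "'a::real_inner"
  shows "norm z ^ 3 / 3 + norm z * (z \<bullet> (x - z)) + norm (x - z) ^ 3 / 6 \<le> norm x ^ 3 / 3"
proof -
  define a b d where "a = norm z" and "b = norm x" and "d = norm (x - z)"
  have nonneg: "0 \<le> a" "0 \<le> b" "0 \<le> d" and d_le: "d \<le> b + a"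
    unfolding a_def b_def d_def by (auto intro: norm_triangle_ineq4)
  have inner: "z \<bullet> (x - z) = (b\<^sup>2 - a\<^sup>2 - d\<^sup>2) / 2"
    unfolding a_def b_def d_def power2_norm_eq_inner
    by (simp add: inner_diff_left inner_diff_right inner_commute field_simps)
  have "0 \<le> (b - a)\<^sup>2 * (2 * b + a) + d\<^sup>2 * (3 * a - d)"
  proof (cases "d \<le> 3 * a")
    case True
    then show ?thesis using nonneg by simp
  next
    case False
    then have "2 * a \<le> b" using d_le by simp
    have "d\<^sup>2 * (d - 3 * a) \<le> (b + a)\<^sup>2 * (b + a - 3 * a)"
      using False nonneg d_le by (intro mult_mono power_mono) auto
    moreover have "(b - a)\<^sup>2 * (2 * b + a) - (b + a)\<^sup>2 * (b + a - 3 * a) = (b - a) ^ 3 + 4 * a ^ 3"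
      by (simp add: power2_eq_square power3_eq_cube algebra_simps)
    moreover have "0 \<le> (b - a) ^ 3 + 4 * a ^ 3" using \<open>2 * a \<le> b\<close> nonneg by simp
    ultimately show ?thesis by (simp add: algebra_simps)
  qed
  also have "\<dots> = 6 * (b ^ 3 / 3 - a ^ 3 / 3 - a * ((b\<^sup>2 - a\<^sup>2 - d\<^sup>2) / 2) - d ^ 3 / 6)"
    by (simp add: power2_eq_square power3_eq_cube field_simps)
  finally show ?thesis
    unfolding inner by (simp add: a_def b_def d_def)
qed

lemma quadratic_has_derivative:
  fixes Q :: "'a::real_inner \<Rightarrow>\<^sub>L 'a"
  assumes sym: "\<And>u v. Q u \<bullet> v = Q v \<bullet> u"
  shows "((\<lambda>s. p \<bullet> s + 1/2 * (Q s \<bullet> s)) has_derivative (\<lambda>h. (p + Q s) \<bullet> h)) (at s)"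
proof -
  have "((\<lambda>s. p \<bullet> s + 1/2 * (Q s \<bullet> s)) has_derivative
      (\<lambda>h. p \<bullet> h + 1/2 * (Q s \<bullet> h + Q h \<bullet> s))) (at s)"
    by (intro has_derivative_add has_derivative_mult_right has_derivative_inner
        has_derivative_inner_right has_derivative_ident bounded_linear_imp_has_derivative
        blinfun.bounded_linear_right)
  moreover have "p \<bullet> h + 1/2 * (Q s \<bullet> h + Q h \<bullet> s) = (p + Q s) \<bullet> h" for h
    unfolding sym[of h s] by (simp add: inner_add_left)
  ultimately show ?thesis by simp
qed

lemma is_minimizer_arg_min:
  fixes F :: "'a \<Rightarrow> real"
  assumes "\<And>y. F x \<le> F y"
  shows "F (arg_min F (\<lambda>_. True)) \<le> F y"
  using arg_min_equality[of "\<lambda>_. True" x F] assms by simp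

text \<open>
  Covers both minimizations of the method: the cubic step, and, with \<open>Q = 0\<close>, the estimating
  functions \<open>\<psi>\<close>. The cubic term dominates outside a ball, so a minimizer exists.
\<close>
lemma cubic_model_arg_min:
  fixes p x0 :: "'a::euclidean_space" and Q :: "'a \<Rightarrow>\<^sub>L 'a" and k c :: real
  assumes sym: "\<And>u v. Q u \<bullet> v = Q v \<bullet> u" and psd: "\<And>u. 0 \<le> Q u \<bullet> u" and c: "0 < c"
  defines "m \<equiv> \<lambda>x. k + p \<bullet> (x - x0) + 1/2 * (Q (x - x0) \<bullet> (x - x0)) + c * norm (x - x0) ^ 3"
  defines "z \<equiv> arg_min m (\<lambda>_. True)"
  shows "p + Q (z - x0) + (3 * c * norm (z - x0)) *\<^sub>R (z - x0) = 0"
proof -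
  have far: "m x0 \<le> m x" if "x \<notin> cball x0 (sqrt (norm p / c))" for x
  proof -
    let ?d = "norm (x - x0)"
    have d: "sqrt (norm p / c) < ?d" using that by (simp add: dist_norm norm_minus_commute)
    then have "(sqrt (norm p / c))\<^sup>2 < ?d\<^sup>2"
      using c by (intro power_strict_mono) auto
    then have "norm p / c < ?d\<^sup>2" using c by simp
    then have "norm p \<le> c * ?d\<^sup>2" using c by (simp add: field_simps)
    then have "0 \<le> ?d * (c * ?d\<^sup>2 - norm p)" by simp
    moreover have "- (norm p * ?d) \<le> p \<bullet> (x - x0)"
      using Cauchy_Schwarz_ineq2[of p "x - x0"] by (simp add: abs_le_iff)
    ultimately show ?thesis
      using psd[of "x - x0"] unfolding m_def
      by (simp add: power2_eq_square power3_eq_cube algebra_simps)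
  qed
  have cont: "continuous_on S m" for S
    unfolding m_def by (intro continuous_intros)
  have "sqrt (norm p / c) \<ge> 0" using c by simp
  then obtain x1 where x1: "x1 \<in> cball x0 (sqrt (norm p / c))"
    "\<And>y. y \<in> cball x0 (sqrt (norm p / c)) \<Longrightarrow> m x1 \<le> m y"
    using continuous_attains_inf[OF compact_cball _ cont, of x0 "sqrt (norm p / c)"] by auto
  have "m x1 \<le> m x0" using x1(2) c by simp
  then have "m x1 \<le> m y" for y
    using x1(2)[of y] far[of y] by (cases "y \<in> cball x0 (sqrt (norm p / c))") auto
  then have min: "m z \<le> m x" for x
    unfolding z_def by (rule is_minimizer_arg_min)
  let ?s = "z - x0"
  let ?q = "p + Q ?s + (3 * c * norm ?s) *\<^sub>R ?s"
  have "((\<lambda>s. (p \<bullet> s + 1/2 * (Q s \<bullet> s)) + c * norm s ^ 3) has_derivative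
      (\<lambda>h. (p + Q ?s) \<bullet> h + c * (3 * norm ?s * (?s \<bullet> h)))) (at ?s)"
    by (intro has_derivative_add quadratic_has_derivative sym has_derivative_mult_right
        norm_cube_has_derivative)
  moreover have "(p \<bullet> ?s + 1/2 * (Q ?s \<bullet> ?s)) + c * norm ?s ^ 3
      \<le> (p \<bullet> s + 1/2 * (Q s \<bullet> s)) + c * norm s ^ 3" for s
    using min[of "s + x0"] unfolding m_def by simp
  ultimately have "(\<lambda>h. (p + Q ?s) \<bullet> h + c * (3 * norm ?s * (?s \<bullet> h))) = (\<lambda>h. 0)"
    by (intro has_derivative_local_min) auto
  from fun_cong[OF this, of ?q] have "?q \<bullet> ?q = 0"
    by (simp add: inner_add_left inner_add_right algebra_simps)
  then show "?q = 0" by simp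
qed

text \<open>
  The quadratic model is minimized over a ball. The variational inequality there says that the
  model gradient at the solution is zero or points from the solution towards the centre, with the
  solution on the boundary; the second conclusion states both cases at once.
\<close>
lemma trust_region_minimizer:
  fixes p :: "'a::euclidean_space" and Q :: "'a \<Rightarrow>\<^sub>L 'a"
  assumes sym: "\<And>u v. Q u \<bullet> v = Q v \<bullet> u" and b: "0 < b"
  obtains s where "norm s \<le> b" "(p + Q s) \<bullet> s \<le> - (b * norm (p + Q s))"
proof -
  let ?m = "\<lambda>s. p \<bullet> s + 1/2 * (Q s \<bullet> s)"
  have "continuous_on (cball 0 b) ?m" by (intro continuous_intros)
  then obtain s where s: "s \<in> cball 0 b" "\<And>x. x \<in> cball 0 b \<Longrightarrow> ?m s \<le> ?m x"
    using continuous_attains_inf[OF compact_cball, of 0 b ?m] b by auto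
  let ?q = "p + Q s"
  have vi: "0 \<le> ?q \<bullet> (x - s)" if x: "x \<in> cball 0 b" for x
  proof -
    define d where "d = x - s"
    have "- (1/2 * (Q d \<bullet> d)) * t \<le> ?q \<bullet> d" if t: "0 < t" "t < 1" for t
    proof -
      have "s + t *\<^sub>R d = (1 - t) *\<^sub>R s + t *\<^sub>R x" by (simp add: d_def algebra_simps)
      then have "s + t *\<^sub>R d \<in> cball 0 b"
        using convexD[OF convex_cball s(1) x, of "1 - t" t] t by simp
      from s(2)[OF this] have "0 \<le> t * (?q \<bullet> d + 1/2 * (Q d \<bullet> d) * t)"
        by (simp add: blinfun.add_right blinfun.scaleR_right inner_add_left inner_add_right
            sym[of d s] algebra_simps)
      with t show ?thesis by (simp add: zero_le_mult_iff)
    qed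
    then have ev: "eventually (\<lambda>t. - (1/2 * (Q d \<bullet> d)) * t \<le> ?q \<bullet> d) (at_right 0)"
      unfolding eventually_at_right_field by (intro exI[of _ 1]) auto
    have "((\<lambda>t. - (1/2 * (Q d \<bullet> d)) * t) \<longlongrightarrow> - (1/2 * (Q d \<bullet> d)) * 0) (at_right 0)"
      by (intro tendsto_intros)
    then show ?thesis
      using tendsto_upperbound[OF _ ev] by (simp add: d_def)
  qed
  have "?q \<bullet> s \<le> - (b * norm ?q)"
  proof (cases "?q = 0")
    case False
    have "- (b / norm ?q) *\<^sub>R ?q \<in> cball 0 b" using b by simp
    from vi[OF this] have "?q \<bullet> s \<le> - ((b / norm ?q) * (norm ?q)\<^sup>2)"
      unfolding inner_diff_right power2_norm_eq_inner by simp
    also have "\<dots> = - (b * norm ?q)" using False by (simp add: power2_eq_square)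
    finally show ?thesis .
  qed simp
  with s(1) show ?thesis by (intro that) auto
qed

text \<open>
  A shorter step leaves a larger model gradient: if a regularized step \<open>s\<close> leaves the ball, then the
  model gradient at the trust-region step is at least the one at \<open>s\<close>, which is \<open>\<mu> * norm s\<close>. This is
  monotonicity of \<open>Q\<close> tested on \<open>s - s'\<close>.
\<close>
lemma trust_region_gradient_ge:
  fixes p s s' :: "'a::euclidean_space" and Q :: "'a \<Rightarrow>\<^sub>L 'a"
  assumes psd: "\<And>u. 0 \<le> Q u \<bullet> u" and opt: "p + Q s + \<mu> *\<^sub>R s = 0" and l: "0 \<le> \<mu>"
    and s': "norm s' \<le> b" "(p + Q s') \<bullet> s' \<le> - (b * norm (p + Q s'))" and far: "b < norm s"
  shows "\<mu> * norm s \<le> norm (p + Q s')"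
proof -
  let ?q = "p + Q s'" and ?r = "norm s"
  have Qs: "Q s = - p - \<mu> *\<^sub>R s" using opt by (simp add: eq_neg_iff_add_eq_0 algebra_simps)
  have "0 \<le> Q (s - s') \<bullet> (s - s')" by (rule psd)
  also have "Q (s - s') = - (\<mu> *\<^sub>R s) - ?q" by (simp add: blinfun.diff_right Qs)
  also have "(- (\<mu> *\<^sub>R s) - ?q) \<bullet> (s - s') = - (\<mu> * ?r\<^sup>2) + \<mu> * (s \<bullet> s') - ?q \<bullet> s + ?q \<bullet> s'"
    unfolding inner_diff_left inner_diff_right inner_minus_left inner_scaleR_left
    by (simp add: power2_norm_eq_inner)
  also have "\<dots> \<le> - (\<mu> * ?r\<^sup>2) + \<mu> * (?r * b) + norm ?q * ?r - b * norm ?q"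
  proof -
    have "s \<bullet> s' \<le> ?r * norm s'" by (rule norm_cauchy_schwarz)
    also have "\<dots> \<le> ?r * b" using s'(1) by (intro mult_left_mono) auto
    finally have "\<mu> * (s \<bullet> s') \<le> \<mu> * (?r * b)" using l by (rule mult_left_mono)
    moreover have "- (?q \<bullet> s) \<le> norm ?q * ?r"
      using Cauchy_Schwarz_ineq2[of ?q s] by (simp add: abs_le_iff)
    ultimately show ?thesis using s'(2) by simp
  qed
  also have "\<dots> = (norm ?q - \<mu> * ?r) * (?r - b)"
    by (simp add: power2_eq_square algebra_simps)
  finally show ?thesis using far by (simp add: zero_le_mult_iff)
qed

section \<open>Acceptance of trial steps\<close>

text \<open>
  If the gradient at the new point is nearly \<open>- (15/2) M norm s *\<^sub>R s\<close>, then expanding the square of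
  the residual bounds \<open>- (g (v + s) \<bullet> s)\<close> from below by
  \<open>((norm (g (v + s)))\<^sup>2 + c * M\<^sup>2 * norm s ^ 4) / (15 * M * norm s)\<close>, and the arithmetic-geometric mean
  inequality eliminates \<open>norm s\<close>.
\<close>
lemma accepted_if_small_residual:
  assumes M: "0 < M"
    and res: "norm (g (v + s) + (15 / 2 * M * norm s) *\<^sub>R s) \<le> 2 * M * (norm s)\<^sup>2"
  shows "accepted g M v (v + s)"
proof (cases "s = 0")
  case True
  then show ?thesis using res by (simp add: accepted_def)
next
  case False
  let ?r = "norm s" and ?q = "g (v + s)"
  define m h where "m = sqrt M" and "h = sqrt (norm ?q)"
  have m: "0 < m" "M = m\<^sup>2" and h: "0 \<le> h" "norm ?q = h\<^sup>2"
    using M by (auto simp: m_def h_def)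
  have r: "0 < ?r" using False by simp
  have powr: "norm ?q powr (3/2) = h ^ 3"
    using powr_add[of "norm ?q" 1 "1/2"]
    by (simp add: powr_half_sqrt h_def power3_eq_cube)
  have "(norm (?q + (15 / 2 * M * ?r) *\<^sub>R s))\<^sup>2 \<le> (2 * M * ?r\<^sup>2)\<^sup>2"
    using res by (intro power_mono) auto
  moreover have "(norm (?q + (15 / 2 * M * ?r) *\<^sub>R s))\<^sup>2
      = (norm ?q)\<^sup>2 + 15 * M * ?r * (?q \<bullet> s) + (15 / 2 * M * ?r)\<^sup>2 * ?r\<^sup>2"
    unfolding power2_norm_eq_inner
    by (simp add: inner_add_left inner_add_right inner_commute power2_eq_square algebra_simps)
  ultimately have "(h\<^sup>2)\<^sup>2 + 209 / 4 * (m * ?r) ^ 4 \<le> 15 * m\<^sup>2 * ?r * - (?q \<bullet> s)"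
    unfolding h m(2) by (simp add: power2_eq_square power4_eq_xxxx algebra_simps)
  moreover have "10 / 3 * p * h ^ 3 \<le> (h\<^sup>2)\<^sup>2 + 209 / 4 * p ^ 4" for p :: real
  proof -
    have "(h\<^sup>2)\<^sup>2 + 209 / 4 * p ^ 4 - 10 / 3 * p * h ^ 3
        = h\<^sup>2 * (h - 10 / 3 * p)\<^sup>2 / 2 + (h\<^sup>2 - 50 / 9 * p\<^sup>2)\<^sup>2 / 2 + 11929 / 324 * (p\<^sup>2)\<^sup>2"
      by (simp add: power2_eq_square power3_eq_cube power4_eq_xxxx field_simps)
    moreover have "0 \<le> h\<^sup>2 * (h - 10 / 3 * p)\<^sup>2 / 2 + (h\<^sup>2 - 50 / 9 * p\<^sup>2)\<^sup>2 / 2 + 11929 / 324 * (p\<^sup>2)\<^sup>2"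
      by simp
    ultimately show ?thesis by linarith
  qed
  note this[of "m * ?r"]
  ultimately have "(15 * m\<^sup>2 * ?r) * (2 / (9 * m) * h ^ 3) \<le> (15 * m\<^sup>2 * ?r) * - (?q \<bullet> s)"
    using m by (simp add: power2_eq_square)
  then have "2 / (9 * m) * h ^ 3 \<le> - (?q \<bullet> s)"
    using m r by (simp only: mult_le_cancel_left_pos mult_pos_pos zero_less_power zero_less_numeral)
  then show ?thesis by (simp add: accepted_def powr m_def)
qed

text \<open>
  The inequality between constants on which the acceptance proof rests; \<open>d ^ 3\<close> is replaced by a
  tangent line close to the critical point of the difference of the two sides.
\<close>
lemma trust_region_constants:
  fixes a d :: real
  assumes "0 \<le> d" "d \<le> 1" and a: "a \<le> 1 / 20 \<or> a \<le> 1 / 10 - 2 / 5 * d ^ 3"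
  shows "29 * (3 - 12 * d ^ 3) < 15 / 2 * (26 - 32 * a - 32 * d - 32 * (a * d))"
proof -
  have tangent: "3 * t\<^sup>2 * d - 2 * t ^ 3 \<le> d ^ 3" if "0 \<le> t" for t
  proof -
    have "d ^ 3 - (3 * t\<^sup>2 * d - 2 * t ^ 3) = (d - t)\<^sup>2 * (d + 2 * t)"
      by (simp add: power2_eq_square power3_eq_cube algebra_simps)
    moreover have "0 \<le> (d - t)\<^sup>2 * (d + 2 * t)" using that assms by simp
    ultimately show ?thesis by simp
  qed
  from a show ?thesis
  proof
    assume a: "a \<le> 1 / 20"
    have "a * d \<le> 1 / 20 * d" using a assms by (intro mult_right_mono) auto
    with a tangent[of "49 / 100"] assms show ?thesis by (simp add: power2_eq_square power3_eq_cube)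
  next
    assume a: "a \<le> 1 / 10 - 2 / 5 * d ^ 3"
    have "a * d \<le> (1 / 10 - 2 / 5 * d ^ 3) * d" using a assms by (intro mult_right_mono) auto
    moreover have "0 \<le> d ^ 3 * d" using assms by simp
    ultimately have "a * d \<le> 1 / 10 * d" by (simp add: algebra_simps)
    with a tangent[of "44 / 100"] assms show ?thesis by (simp add: power2_eq_square power3_eq_cube)
  qed
qed

context convex_C2
begin

lemma cubic_step_optimality:
  assumes "0 < M"
  shows "g v + H v (cubic_step g H M v) + (15 / 2 * M * norm (cubic_step g H M v)) *\<^sub>R cubic_step g H M v = 0"
proof -
  have "cubic_step g H M v = arg_min (\<lambda>x. 0 + g v \<bullet> (x - 0) + 1/2 * (H v (x - 0) \<bullet> (x - 0))
      + 15 * M / 6 * norm (x - 0) ^ 3) (\<lambda>_. True)"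
    by (simp add: cubic_step_def)
  then show ?thesis
    using cubic_model_arg_min[where Q = "H v" and c = "15 * M / 6" and k = 0 and p = "g v" and ?x0.0 = 0] assms hessian_sym hessian_psd
    by (simp add: mult_ac)
qed

lemma cubic_step_le:
  assumes "0 < M"
  shows "15 / 2 * M * (norm (cubic_step g H M v))\<^sup>2 \<le> norm (g v)"
proof -
  define s where "s = cubic_step g H M v"
  have "0 = (g v + H v s + (15 / 2 * M * norm s) *\<^sub>R s) \<bullet> s"
    using cubic_step_optimality[OF assms, of v] by (simp add: s_def)
  also have "\<dots> = g v \<bullet> s + H v s \<bullet> s + 15 / 2 * M * norm s * (norm s)\<^sup>2"
    unfolding inner_add_left inner_scaleR_left power2_norm_eq_inner by simp
  finally have "15 / 2 * M * norm s * (norm s)\<^sup>2 \<le> norm (g v) * norm s"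
    using hessian_psd[of v s] Cauchy_Schwarz_ineq2[of "g v" s] by (simp add: abs_le_iff)
  then have "norm s * (15 / 2 * M * (norm s)\<^sup>2) \<le> norm s * norm (g v)"
    by (simp add: algebra_simps)
  then have "15 / 2 * M * (norm s)\<^sup>2 \<le> norm (g v)"
    by (cases "norm s = 0") (auto dest: mult_left_le_imp_le)
  then show ?thesis by (simp add: s_def)
qed

lemma cubic_step_residual:
  assumes "0 < M" "s = cubic_step g H M v"
  shows "g (v + s) + (15 / 2 * M * norm s) *\<^sub>R s = g (v + s) - g v - H v s"
proof -
  have "(15 / 2 * M * norm s) *\<^sub>R s = - (g v + H v s)"
    using cubic_step_optimality[OF assms(1), of v] unfolding assms(2)[symmetric]
    by (rule minus_unique[symmetric])
  then show ?thesis by simp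
qed

lemma accepted_if_small_taylor_error:
  assumes M: "0 < M" and s: "s = cubic_step g H M v"
    and err: "norm (g (v + s) - g v - H v s) \<le> 2 * M * (norm s)\<^sup>2"
  shows "accepted g M v (v + s)"
  using err by (intro accepted_if_small_residual[OF M]) (simp only: cubic_step_residual[OF M s])

text \<open>
  The heart of the proof. Although the gradient at \<open>v\<close> is not controlled, a trial from \<open>v\<close> succeeds as
  soon as an almost optimal point \<open>y\<close> lies near \<open>v\<close>. The radius \<open>b\<close> is such that generalized
  smoothness on \<open>b\<close>-balls behaves like ordinary Lipschitz continuity with a constant below \<open>M\<close>, up to
  a small multiple of the end gradient. If the cubic step is no longer than \<open>b\<close>, the Taylor error at
  its end is small and the trial is accepted. If it is longer, consider the step \<open>s'\<close> of the
  trust-region problem on the \<open>b\<close>-ball: the model gradient there is at least \<open>15/2 * M * b\<^sup>2\<close> and points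
  back to \<open>v\<close>, and the true gradient is close to it. By convexity, \<open>f y - f (v + s')\<close> would then be
  larger than the optimality gap of \<open>y\<close>.
  
  The two alternatives for \<open>M0\<close> serve two purposes: \<open>4 * M0 \<le> M\<close> can be ensured without knowing
  the optimality gap, while the other one, together with the trade-off between the gap of \<open>y\<close> and
  its distance from \<open>v\<close>, leads to the sharp bound on the total number of rejections.
\<close>
lemma accepted_if_near_almost_optimal:
  assumes smooth: "local_gen_smooth g H M0 M1 \<rho>" and M0: "0 \<le> M0" and M1: "0 \<le> M1"
    and M: "0 < M" and b: "0 < b" "b \<le> \<rho>" "M1 * b\<^sup>2 \<le> 1 / 16"
    and gap: "\<And>x. f y - f x + 12 * M * norm (y - v) ^ 3 \<le> 3 * M * b ^ 3"
    and M0_le: "4 * M0 \<le> M \<or> M0 * b ^ 3 + 2 * M * norm (y - v) ^ 3 \<le> M / 2 * b ^ 3"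
  shows "accepted g M v (v + cubic_step g H M v)"
proof -
  define s where "s = cubic_step g H M v"
  define r where "r = norm s"
  \<comment> \<open>Scale-free quantities: the distance in units of \<open>b\<close>, and the part of the Taylor error due to \<open>M0\<close>
    in units of \<open>15/2 * M * b\<^sup>2\<close>.\<close>
  define d where "d = norm (y - v) / b"
  define a where "a = M0 / (5 * M)"
  have d: "0 \<le> d" "norm (y - v) = d * b" using b by (auto simp: d_def)
  have a: "0 \<le> a" "M0 = 5 * a * M" using M M0 by (auto simp: a_def)
  have Mb: "0 < M * b ^ 3" using M b by simp
  have "(M * b ^ 3) * (12 * d ^ 3) \<le> (M * b ^ 3) * 3"
    using gap[of y] unfolding d by (simp add: power_mult_distrib mult_ac)
  then have "12 * d ^ 3 \<le> 3" using Mb mult_le_cancel_left_pos by blast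
  then have "d ^ 3 \<le> 1 ^ 3" by simp
  then have d1: "d \<le> 1" by (intro power_le_imp_le_base[of d 2 1]) auto
  have a_le: "a \<le> 1 / 20 \<or> a \<le> 1 / 10 - 2 / 5 * d ^ 3"
  proof (use M0_le in \<open>elim disjE\<close>)
    assume "M0 * b ^ 3 + 2 * M * norm (y - v) ^ 3 \<le> M / 2 * b ^ 3"
    then have "(M * b ^ 3) * (5 * a + 2 * d ^ 3) \<le> (M * b ^ 3) * (1 / 2)"
      unfolding d a by (simp add: power_mult_distrib algebra_simps)
    then have "5 * a + 2 * d ^ 3 \<le> 1 / 2" using Mb mult_le_cancel_left_pos by blast
    then show ?thesis by simp
  qed (use a M in auto)
  have a10: "a \<le> 1 / 10" using a_le zero_le_power[OF d(1), of 3] by linarith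
  have err: "norm (g (v + u) - g v - H v u) \<le> 15 / 2 * a * (M * t\<^sup>2) + 3 / 32 * norm (g (v + u))"
    if u: "norm u \<le> t" "t \<le> b" for u t
  proof -
    have "norm u \<le> \<rho>" using u b by simp
    then have "norm (g (v + u) - g v - H v u) \<le> 3 / 2 * (M0 + M1 * norm (g (v + u))) * (norm u)\<^sup>2"
      by (intro taylor_center_end) (use smooth in \<open>auto simp: local_gen_smooth_def\<close>)
    also have "\<dots> \<le> 3 / 2 * (M0 + M1 * norm (g (v + u))) * t\<^sup>2"
      using u M0 M1 by (intro mult_left_mono power_mono) auto
    also have "\<dots> = 15 / 2 * a * (M * t\<^sup>2) + 3 / 2 * ((M1 * t\<^sup>2) * norm (g (v + u)))"
      by (simp add: a algebra_simps)
    also have "\<dots> \<le> 15 / 2 * a * (M * t\<^sup>2) + 3 / 2 * ((1 / 16) * norm (g (v + u)))"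
    proof (intro add_left_mono mult_left_mono mult_right_mono)
      have "t \<ge> 0" using u(1) norm_ge_zero[of u] by linarith
      then have "M1 * t\<^sup>2 \<le> M1 * b\<^sup>2" using u M1 by (intro mult_left_mono power_mono) auto
      with b show "M1 * t\<^sup>2 \<le> 1 / 16" by simp
    qed auto
    finally show ?thesis by simp
  qed
  have "accepted g M v (v + s)"
  proof (cases "r \<le> b")
    case True
    let ?e = "g (v + s) - g v - H v s"
    have "g (v + s) = ?e - (15 / 2 * M * r) *\<^sub>R s"
      using cubic_step_residual[OF M s_def] by (simp add: r_def)
    then have "norm (g (v + s)) \<le> norm ?e + norm ((15 / 2 * M * r) *\<^sub>R s)"
      by (metis norm_triangle_ineq4)
    also have "norm ((15 / 2 * M * r) *\<^sub>R s) = 15 / 2 * (M * r\<^sup>2)"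
      using M by (simp add: r_def power2_eq_square)
    finally have "norm (g (v + s)) \<le> norm ?e + 15 / 2 * (M * r\<^sup>2)" .
    moreover have X: "0 \<le> M * r\<^sup>2" using M by simp
    moreover have "norm ?e \<le> 15 / 2 * a * (M * r\<^sup>2) + 3 / 32 * norm (g (v + s))"
      using True by (intro err) (auto simp: r_def)
    moreover have "a * (M * r\<^sup>2) \<le> 1 / 10 * (M * r\<^sup>2)" using a10 X by (rule mult_right_mono)
    ultimately have "norm ?e \<le> 2 * (M * r\<^sup>2)" by linarith
    then show ?thesis
      by (intro accepted_if_small_taylor_error[OF M s_def]) (simp add: r_def)
  next
    case False
    obtain s' where s': "norm s' \<le> b" "(g v + H v s') \<bullet> s' \<le> - (b * norm (g v + H v s'))"
      using trust_region_minimizer[OF hessian_sym \<open>0 < b\<close>, where p = "g v"] by blast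
    let ?q = "g v + H v s'" and ?w = "v + s'"
    let ?e = "g ?w - g v - H v s'"
    define P where "P = norm ?q"
    have "15 / 2 * M * r * r \<le> P"
      unfolding r_def P_def
      by (rule trust_region_gradient_ge[OF hessian_psd _ _ s'])
        (use cubic_step_optimality[OF M, of v] False M in \<open>auto simp: s_def r_def\<close>)
    moreover have "M * b\<^sup>2 \<le> M * (r * r)"
      using False b M by (auto simp: power2_eq_square intro!: mult_mono)
    ultimately have P: "15 / 2 * (M * b\<^sup>2) \<le> P" by simp
    have G: "norm (g ?w) \<le> P + norm ?e"
      using norm_triangle_ineq[of ?q ?e] by (simp add: P_def)
    have "a * (15 / 2 * (M * b\<^sup>2)) \<le> a * P" using P a by (intro mult_left_mono) auto
    then have E: "norm ?e \<le> a * P + 3 / 32 * norm (g ?w)"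
      using err[of s' b] s'(1) by simp
    have E': "29 * norm ?e \<le> 32 * (a * P) + 3 * P" and G': "29 * norm (g ?w) \<le> 32 * P + 32 * (a * P)"
      using G E by linarith+
    have combine: "29 * c - Y - Z \<le> 29 * (F1 - F2)"
      if "T = - U - V + W" "29 * V \<le> Y" "- (29 * W) \<le> Z" "F2 + T \<le> F1" "U \<le> - c"
      for c Y Z F1 F2 T U V W :: real
      using that by argo
    have "g ?w \<bullet> (y - ?w) = - (?q \<bullet> s') - ?e \<bullet> s' + g ?w \<bullet> (y - v)"
      by (simp add: inner_diff_left inner_diff_right inner_add_left inner_add_right)
    moreover have "29 * (?e \<bullet> s') \<le> (32 * (a * P) + 3 * P) * b"
    proof -
      have "29 * (?e \<bullet> s') \<le> (29 * norm ?e) * norm s'"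
        using norm_cauchy_schwarz[of ?e s'] by simp
      also have "\<dots> \<le> (32 * (a * P) + 3 * P) * b"
      proof (rule mult_mono)
        show "0 \<le> 32 * (a * P) + 3 * P" using a by (simp add: P_def)
      qed (use E' s' in auto)
      finally show ?thesis .
    qed
    moreover have "- (29 * (g ?w \<bullet> (y - v))) \<le> (32 * (P + a * P)) * (d * b)"
    proof -
      have "- (29 * (g ?w \<bullet> (y - v))) \<le> (29 * norm (g ?w)) * norm (y - v)"
        using norm_cauchy_schwarz[of "g ?w" "v - y"]
        by (simp add: norm_minus_commute inner_diff_right)
      also have "\<dots> \<le> (32 * (P + a * P)) * (d * b)"
      proof (rule mult_mono)
        show "0 \<le> 32 * (P + a * P)" using a by (simp add: P_def)
      qed (use G' d b in auto)
      finally show ?thesis .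
    qed
    moreover have "f ?w + g ?w \<bullet> (y - ?w) \<le> f y" by (rule gradient_ineq)
    ultimately have "29 * (b * P) - (32 * (a * P) + 3 * P) * b - (32 * (P + a * P)) * (d * b)
        \<le> 29 * (f y - f ?w)"
      using s'(2)[folded P_def] by (rule combine)
    also have "29 * (b * P) - (32 * (a * P) + 3 * P) * b - (32 * (P + a * P)) * (d * b)
        = (b * P) * (26 - 32 * a - 32 * d - 32 * (a * d))"
      by (simp add: algebra_simps)
    finally have upper: "(b * P) * (26 - 32 * a - 32 * d - 32 * (a * d)) \<le> 29 * (f y - f ?w)" .
    have key: "29 * (3 - 12 * d ^ 3) < 15 / 2 * (26 - 32 * a - 32 * d - 32 * (a * d))"
      using d d1 a_le by (intro trust_region_constants)
    have "b * (15 / 2 * (M * b\<^sup>2)) \<le> b * P"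
      using P b by (intro mult_left_mono) auto
    then have bP: "(M * b ^ 3) * (15 / 2) \<le> b * P"
      by (simp add: power2_eq_square power3_eq_cube algebra_simps)
    have "29 * ((M * b ^ 3) * (3 - 12 * d ^ 3)) = (M * b ^ 3) * (29 * (3 - 12 * d ^ 3))" by simp
    also have "\<dots> < (M * b ^ 3) * (15 / 2 * (26 - 32 * a - 32 * d - 32 * (a * d)))"
      using key Mb by (rule mult_strict_left_mono)
    also have "\<dots> = ((M * b ^ 3) * (15 / 2)) * (26 - 32 * a - 32 * d - 32 * (a * d))"
      by (simp only: mult.assoc)
    also have "\<dots> \<le> (b * P) * (26 - 32 * a - 32 * d - 32 * (a * d))"
      using key \<open>12 * d ^ 3 \<le> 3\<close> by (intro mult_right_mono[OF bP]) auto
    also note upper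
    finally have "(M * b ^ 3) * (3 - 12 * d ^ 3) < f y - f ?w" by simp
    moreover have "f y - f ?w \<le> (M * b ^ 3) * (3 - 12 * d ^ 3)"
      using gap[of ?w] unfolding d by (simp add: power_mult_distrib algebra_simps)
    ultimately show ?thesis by simp
  qed
  then show ?thesis by (simp add: s_def)
qed

text \<open>
  Here the smoothness constant at the starting point of the step is known, so the Taylor error is
  estimated from there. The step length is at most \<open>\<rho>\<close> by the bound on the cubic step in terms of the
  gradient.
\<close>
lemma accepted_initial:
  assumes smooth: "local_gen_smooth g H M0 M1 \<rho>" and M0: "0 \<le> M0" and M1: "0 \<le> M1"
    and M: "0 < M" "M0 + M1 * norm (g v) \<le> M" and \<rho>: "0 < \<rho>" "2 * norm (g v) / (15 * \<rho>\<^sup>2) \<le> M"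
  shows "accepted g M v (v + cubic_step g H M v)"
proof -
  define s where "s = cubic_step g H M v"
  have "15 / 2 * M * (norm s)\<^sup>2 \<le> norm (g v)" 
    unfolding s_def by (rule cubic_step_le[OF M(1)])
  also have "\<dots> \<le> 15 / 2 * M * \<rho>\<^sup>2" using \<rho> by (simp add: field_simps)
  finally have "(norm s)\<^sup>2 \<le> \<rho>\<^sup>2" using M by simp
  then have r: "norm s \<le> \<rho>" using \<rho> by (auto intro: power2_le_imp_le[OF _ less_imp_le])
  have "norm (g (v + s) - g v - H v s) \<le> M / 2 * (norm s)\<^sup>2"
  proof (rule taylor_center_start)
    fix z assume "norm (z - v) \<le> norm s"
    then have "norm (H z - H v) \<le> (M0 + M1 * norm (g v)) * norm (z - v)"
      using smooth r by (simp add: local_gen_smooth_def)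
    also have "\<dots> \<le> M * norm (z - v)" using M by (intro mult_right_mono) auto
    finally show "norm (H z - H v) \<le> M * norm (z - v)" .
  qed
  also have "\<dots> \<le> 2 * M * (norm s)\<^sup>2" using M by (intro mult_right_mono) auto
  finally have "accepted g M v (v + s)"
    by (rule accepted_if_small_taylor_error[OF M(1) s_def])
  then show ?thesis by (simp add: s_def)
qed

end

section \<open>The estimate sequence\<close>

text \<open>
  The estimating functions inherit uniform convexity of degree three from the norm cubed.
\<close>
lemma linear_cube_model_growth:
  fixes p x0 :: "'a::euclidean_space" and k c :: real
  assumes c: "0 < c"
  defines "m \<equiv> \<lambda>x. k + p \<bullet> (x - x0) + c * norm (x - x0) ^ 3"
  defines "z \<equiv> arg_min m (\<lambda>_. True)"
  shows "m z + c / 2 * norm (x - z) ^ 3 \<le> m x"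
proof -
  let ?Z = "z - x0" and ?X = "x - x0"
  have "p + (3 * c * norm ?Z) *\<^sub>R ?Z = 0"
    using cubic_model_arg_min[where Q = "0 :: 'a \<Rightarrow>\<^sub>L 'a" and k = k and p = p and ?x0.0 = x0 and c = c] c
    by (simp add: z_def m_def)
  then have p: "p = - ((3 * c * norm ?Z) *\<^sub>R ?Z)" by (simp add: eq_neg_iff_add_eq_0)
  have pd: "p \<bullet> (x - z) = - (3 * c * (norm ?Z * (?Z \<bullet> (x - z))))"
    by (subst p) simp
  have "norm ?Z ^ 3 / 3 + norm ?Z * (?Z \<bullet> (?X - ?Z)) + norm (?X - ?Z) ^ 3 / 6 \<le> norm ?X ^ 3 / 3"
    by (rule norm_cube_uniformly_convex)
  then have "(3 * c) * (norm ?Z ^ 3 / 3 + norm ?Z * (?Z \<bullet> (x - z)) + norm (x - z) ^ 3 / 6)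
      \<le> (3 * c) * (norm ?X ^ 3 / 3)"
    using c by (intro mult_left_mono) auto
  then have "c * norm ?Z ^ 3 - p \<bullet> (x - z) + c / 2 * norm (x - z) ^ 3 \<le> c * norm ?X ^ 3"
    unfolding pd by (simp add: algebra_simps)
  moreover have "p \<bullet> ?X = p \<bullet> ?Z + p \<bullet> (x - z)" by (simp add: inner_diff_right)
  ultimately show ?thesis by (simp add: m_def)
qed

text \<open>
  A rejected trial shows that the coefficient was below the threshold \<open>T\<close>; hence the accepted one is
  either the initial one or below \<open>2 * T\<close>.
\<close>
lemma backtracking_terminates:
  fixes M T :: real
  assumes M: "0 < M" and ok: "\<And>i. T \<le> 2 ^ i * M \<Longrightarrow> P i"
  shows "P (LEAST i. P i)" and "(LEAST i. P i) = 0 \<or> 2 ^ (LEAST i. P i) * M < 2 * T"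
proof -
  obtain i where "T / M < 2 ^ i" using real_arch_pow[of 2 "T / M"] by auto
  then have "P i" using M by (intro ok) (simp add: field_simps)
  then show "P (LEAST i. P i)" by (rule LeastI)
  show "(LEAST i. P i) = 0 \<or> 2 ^ (LEAST i. P i) * M < 2 * T"
  proof (cases "LEAST i. P i")
    case (Suc j)
    then have "\<not> P j" using not_less_Least[of j P] by simp
    then have "2 ^ j * M < T" using ok[of j] by force
    with Suc show ?thesis by simp
  qed simp
qed

lemma trial_alpha:
  assumes G: "0 < Gamma_st st" and M: "0 < M"
  shows "0 < trial_alpha st M" "trial_alpha st M < 1"
    "72 * M * trial_alpha st M ^ 3 = (1 - trial_alpha st M) * Gamma_st st"
proof -
  define c where "c = Gamma_st st / (72 * M)"
  let ?P = "\<lambda>\<alpha>::real. 0 < \<alpha> \<and> \<alpha> < 1 \<and> \<alpha> ^ 3 / (1 - \<alpha>) = c"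
  have c: "0 < c" using G M by (simp add: c_def)
  have "\<exists>\<alpha>\<ge>0. \<alpha> \<le> 1 \<and> \<alpha> ^ 3 + c * \<alpha> - c = (0::real)"
    by (rule IVT') (use c in \<open>auto intro!: continuous_intros\<close>)
  then obtain \<alpha> :: real where \<alpha>: "0 \<le> \<alpha>" "\<alpha> \<le> 1" "\<alpha> ^ 3 + c * \<alpha> - c = 0" by blast
  have "\<alpha> \<noteq> 0" "\<alpha> \<noteq> 1" using \<alpha>(3) c by auto
  then have ex: "?P \<alpha>" using \<alpha> by (auto simp: field_simps)
  have uniq: "\<beta> = \<alpha>" if \<beta>: "?P \<beta>" for \<beta>
  proof (rule ccontr)
    assume "\<beta> \<noteq> \<alpha>"
    have eq: "x ^ 3 = c * (1 - x)" if "?P x" for x using that by (auto simp: field_simps)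
    have less: "\<not> x < y" if "?P x" "?P y" for x y
    proof
      assume "x < y"
      then have "x ^ 3 < y ^ 3" using that by (intro power_strict_mono) auto
      then have "c * (1 - x) < c * (1 - y)" using eq[OF that(1)] eq[OF that(2)] by simp
      then show False using \<open>x < y\<close> c by simp
    qed
    from less[OF ex \<beta>] less[OF \<beta> ex] \<open>\<beta> \<noteq> \<alpha>\<close> show False by simp
  qed
  have "trial_alpha st M = \<alpha>"
    unfolding trial_alpha_def c_def[symmetric] using ex uniq by (intro the_equality) blast+
  moreover have "72 * M * \<alpha> ^ 3 = (1 - \<alpha>) * Gamma_st st"
    using ex M by (auto simp: c_def field_simps)
  ultimately show "0 < trial_alpha st M" "trial_alpha st M < 1"
    "72 * M * trial_alpha st M ^ 3 = (1 - trial_alpha st M) * Gamma_st st"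
    using ex by auto
qed

text \<open>
  Young's inequality with the weight \<open>c\<close> chosen such that \<open>\<Gamma> * c\<^sup>2 = 2 * a\<close>. The equation that
  determines \<open>\<alpha>\<close> in the method ensures the hypothesis on \<open>a ^ 3\<close>.
\<close>
lemma estimate_step_ineq:
  fixes a A \<Gamma> M G d :: real
  assumes pos: "0 < a" "0 < A" "0 < \<Gamma>" "0 < M" "0 \<le> G" "0 \<le> d" and a: "18 * M * a ^ 3 \<le> A\<^sup>2 * \<Gamma>"
  shows "a * G * d \<le> A * (2 / (9 * sqrt M) * G powr (3/2)) + \<Gamma> / 6 * d ^ 3"
proof -
  define h c where "h = sqrt G" and "c = sqrt (2 * a / \<Gamma>)"
  have h: "0 \<le> h" "G = h\<^sup>2" and c: "0 \<le> c" "c\<^sup>2 = 2 * a / \<Gamma>"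
    using pos by (auto simp: h_def c_def)
  have powr: "G powr (3/2) = h ^ 3"
    using powr_add[of G 1 "1/2"] pos by (simp add: powr_half_sqrt h_def power3_eq_cube)
  have "(\<Gamma> / 3 * c ^ 3)\<^sup>2 = \<Gamma>\<^sup>2 / 9 * (c\<^sup>2) ^ 3"
    by (simp add: power_mult_distrib power_divide flip: power_mult)
  also have "\<dots> = 8 * a ^ 3 / (9 * \<Gamma>)"
    unfolding c using pos by (simp add: power_divide power_mult_distrib power2_eq_square power3_eq_cube)
  also have "\<dots> \<le> 4 * A\<^sup>2 / (81 * M)"
    using a pos by (simp add: field_simps)
  also have "\<dots> = (A * (2 / (9 * sqrt M)))\<^sup>2"
    using pos by (simp add: power_mult_distrib power_divide)
  finally have "\<Gamma> / 3 * c ^ 3 \<le> A * (2 / (9 * sqrt M))"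
    using pos by (intro power2_le_imp_le[of "\<Gamma> / 3 * c ^ 3"]) auto
  then have 1: "\<Gamma> / 3 * c ^ 3 * h ^ 3 \<le> A * (2 / (9 * sqrt M)) * h ^ 3"
    using h by (intro mult_right_mono) auto
  have "0 \<le> (d - c * h)\<^sup>2 * (d + 2 * (c * h))" using c h pos by simp
  also have "\<dots> = d ^ 3 + 2 * (c * h) ^ 3 - 3 * c\<^sup>2 * h\<^sup>2 * d"
    by (simp add: power2_eq_square power3_eq_cube algebra_simps)
  finally have "\<Gamma> / 6 * (3 * c\<^sup>2 * h\<^sup>2 * d) \<le> \<Gamma> / 6 * (d ^ 3 + 2 * (c * h) ^ 3)"
    using pos by (intro mult_left_mono) auto
  moreover have "\<Gamma> / 6 * (3 * c\<^sup>2 * h\<^sup>2 * d) = a * G * d"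
    unfolding c h(2)[symmetric] using pos by simp
  moreover have "\<Gamma> / 6 * (d ^ 3 + 2 * (c * h) ^ 3) = \<Gamma> / 6 * d ^ 3 + \<Gamma> / 3 * c ^ 3 * h ^ 3"
    by (simp add: power_mult_distrib algebra_simps)
  ultimately show ?thesis
    using 1 unfolding powr by (simp only: mult.assoc)
qed

locale acr = convex_C2 f g H
  for f :: "'a::euclidean_space \<Rightarrow> real" and g :: "'a \<Rightarrow> 'a" and H :: "'a \<Rightarrow> 'a \<Rightarrow>\<^sub>L 'a" +
  fixes x0 xstar :: 'a and M0 M1 Mt0 R \<rho> :: real
  assumes minimizer: "\<And>x. f xstar \<le> f x"
    and M0: "0 \<le> M0" and M1: "0 \<le> M1" and Mt0: "0 < Mt0"
    and R: "R = norm (x0 - xstar)"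
    and \<rho>: "0 < \<rho>" and smooth: "local_gen_smooth g H M0 M1 \<rho>"
    and nonstationary: "g x0 \<noteq> 0"
begin

lemma gradient_zero_at_min: "(\<And>y. f x \<le> f y) \<Longrightarrow> g x = 0"
  using has_derivative_local_min[OF gradient[unfolded gderiv_def], of x]
  by (auto simp: fun_eq_iff dest: spec[of _ "g x"])

lemma min_if_gradient_zero: "g x = 0 \<Longrightarrow> f x \<le> f y"
  using gradient_ineq[of x y] by simp

lemma initial_gap_pos: "f xstar < f x0"
  using gradient_zero_at_min[of x0] nonstationary minimizer by (metis le_less_linear order_trans)

lemma initial_gap_le: "f x0 - f xstar \<le> norm (g x0) * R"
  using gradient_ineq[of x0 xstar] norm_cauchy_schwarz[of "g x0" "x0 - xstar"]
  by (simp add: R inner_diff_right)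

lemma R_pos: "0 < R"
  using initial_gap_pos by (auto simp: R)

definition T0 :: real where
  "T0 = max (M0 + 2 * M1 * norm (g x0)) (2 * norm (g x0) / (15 * \<rho>\<^sup>2))"

definition Mt :: real where "Mt = 2 ^ init_rejections g H x0 Mt0 * Mt0"

lemma init_ok_if: "T0 \<le> 2 ^ i * Mt0 \<Longrightarrow> init_ok g H x0 Mt0 i"
  unfolding init_ok_def init_point_def
  by (rule accepted_initial[OF smooth M0 M1 _ _ \<rho>])
    (use M0 M1 Mt0 in \<open>auto simp: T0_def add.commute intro: order_trans[rotated]\<close>)

lemma init_terminates: "init_ok g H x0 Mt0 (init_rejections g H x0 Mt0)"
  and init_rejections_bound: "init_rejections g H x0 Mt0 = 0 \<or> Mt < 2 * T0"
  using backtracking_terminates[OF Mt0 init_ok_if] nonstationary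
  by (simp_all add: init_rejections_def Mt_def)

lemma Mt_ge: "Mt0 \<le> Mt"
  using Mt0 mult_right_mono[of 1 "2 ^ init_rejections g H x0 Mt0" Mt0]
  by (simp add: Mt_def)

lemma Mt_le: "Mt \<le> max Mt0 (2 * T0)"
  using init_rejections_bound by (auto simp: Mt_def)

definition xt :: 'a where "xt = init_point g H x0 Mt"

lemma init_decrease: "2 / (9 * sqrt Mt) * norm (g xt) powr (3/2) \<le> f x0 - f xt"
proof -
  have "2 / (9 * sqrt Mt) * norm (g xt) powr (3/2) \<le> g xt \<bullet> (x0 - xt)"
    using init_terminates by (simp add: init_ok_def accepted_def Mt_def xt_def)
  also have "\<dots> \<le> f x0 - f xt" using gradient_ineq[of xt x0] by simp
  finally show ?thesis .
qed

lemma init_decrease_pos: "0 < f x0 - f xt"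
proof (cases "g xt = 0")
  case True
  then show ?thesis
    using min_if_gradient_zero[of xt xstar] initial_gap_pos by simp
next
  case False
  have "0 < Mt" using Mt_ge Mt0 by simp
  then have "0 < 2 / (9 * sqrt Mt) * norm (g xt) powr (3/2)" using False by simp
  with init_decrease show ?thesis by linarith
qed

definition \<Gamma>0 :: real where "\<Gamma>0 = Gamma0 f g H x0 Mt0"

lemma \<Gamma>0_eq: "\<Gamma>0 = 3 * norm (g x0) ^ 3 / (f x0 - f xt)\<^sup>2"
  by (simp add: \<Gamma>0_def Gamma0_def xt_def Mt_def)

lemma \<Gamma>0_pos: "0 < \<Gamma>0"
  using init_decrease_pos nonstationary by (simp add: \<Gamma>0_eq)

text \<open>
  The reason for the choice of \<open>\<Gamma>0\<close>: the decrease of the initialization step is at most the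
  optimality gap \<open>\<Delta>\<close> at \<open>x0\<close>, and \<open>\<Delta> \<le> norm (g x0) * R\<close>, whence
  \<open>\<Gamma>0 * R ^ 3 / 3 \<ge> \<Delta> ^ 3 / \<Delta>\<^sup>2 = \<Delta>\<close>.
\<close>
lemma initial_gap_le_\<Gamma>0: "f x0 - f xstar \<le> \<Gamma>0 / 3 * R ^ 3"
proof -
  let ?\<Delta> = "f x0 - f xstar" and ?D = "f x0 - f xt"
  have "?D \<le> ?\<Delta>" using minimizer by simp
  then have "?D\<^sup>2 \<le> ?\<Delta>\<^sup>2" using init_decrease_pos by (intro power_mono) auto
  then have "?\<Delta> * ?D\<^sup>2 \<le> ?\<Delta> * ?\<Delta>\<^sup>2" using initial_gap_pos by (intro mult_left_mono) auto
  also have "\<dots> = ?\<Delta> ^ 3" by (simp add: power2_eq_square power3_eq_cube)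
  also have "\<dots> \<le> (norm (g x0) * R) ^ 3"
    using initial_gap_le initial_gap_pos by (intro power_mono) auto
  finally have "?\<Delta> * ?D\<^sup>2 \<le> norm (g x0) ^ 3 * R ^ 3" by (simp add: power_mult_distrib)
  then show ?thesis using init_decrease_pos by (simp add: \<Gamma>0_eq field_simps)
qed

text \<open>
  The estimate sequence. The bound from below implies \<open>A * f w \<le> min \<psi>\<close> and records in addition the
  growth of \<open>\<psi>\<close> away from \<open>z\<close>, which is needed to locate \<open>z\<close>. In the bound from above, \<open>f x0\<close> stays in
  place of one copy of \<open>f x\<close>, since \<open>\<psi>\<close> starts with the value of \<open>f\<close> at \<open>x0\<close> instead of with an affine
  minorant.
\<close>
definition invariant :: "'a acr_data \<Rightarrow> bool" where
  "invariant st \<longleftrightarrow>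
     0 < Gamma_st st \<and> 0 < A_st st \<and> A_st st * Gamma_st st = \<Gamma>0 \<and> 0 < reg_st st \<and>
     (\<exists>k p. psi_st st = (\<lambda>x. k + p \<bullet> (x - x0) + \<Gamma>0 / 3 * norm (x - x0) ^ 3)) \<and>
     (\<forall>x. A_st st * f (w_st st) + \<Gamma>0 / 6 * norm (x - z_st st) ^ 3 \<le> psi_st st x) \<and>
     (\<forall>x. psi_st st x \<le> (A_st st - 1) * f x + f x0 + \<Gamma>0 / 3 * norm (x - x0) ^ 3)"

lemma invariant_init: "invariant (init_state f g H x0 Mt0)"
  using \<Gamma>0_pos
  by (auto simp: invariant_def init_state_def Let_def \<Gamma>0_def[symmetric] intro!: exI[of _ "0::'a"])

lemma invariant_step:
  assumes inv: "invariant st" and ok: "main_ok g H st (main_rejections g H st)"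
  shows "invariant (next_state f g H st)"
proof -
  define M \<alpha> A' where "M = 2 ^ main_rejections g H st * reg_st st"
    and "\<alpha> = trial_alpha st M" and "A' = A_st st / (1 - \<alpha>)"
  define a v w where "a = \<alpha> * A'" and "v = trial_v st M" and "w = trial_w g H st M"
  define \<psi> where "\<psi> = (\<lambda>x. psi_st st x + a * (f w + g w \<bullet> (x - w)))"
  define z where "z = arg_min \<psi> (\<lambda>_. True)"
  let ?A = "A_st st" and ?\<Gamma> = "Gamma_st st"
  have next_eq: "next_state f g H st = \<lparr> w_st = w, z_st = z, A_st = A', Gamma_st = (1 - \<alpha>) * ?\<Gamma>,
           reg_st = (1 - \<alpha>) * ?\<Gamma> / ?\<Gamma> * M, psi_st = \<psi> \<rparr>"
    by (simp add: next_state_def Let_def M_def \<alpha>_def A'_def a_def w_def \<psi>_def z_def)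
  have pos: "0 < ?\<Gamma>" "0 < ?A" "0 < M" and A\<Gamma>: "?A * ?\<Gamma> = \<Gamma>0"
    using inv by (auto simp: invariant_def M_def)
  have \<alpha>: "0 < \<alpha>" "\<alpha> < 1" "72 * M * \<alpha> ^ 3 = (1 - \<alpha>) * ?\<Gamma>"
    unfolding \<alpha>_def using trial_alpha pos by blast+
  have A': "0 < A'" "(1 - \<alpha>) * A' = ?A" and a: "0 < a" "?A + a = A'"
    using \<alpha> pos by (auto simp: A'_def a_def field_simps)
  have lower0: "?A * f (w_st st) + \<Gamma>0 / 6 * norm (x - z_st st) ^ 3 \<le> psi_st st x" for x
    using inv by (auto simp: invariant_def)
  have "72 * M * a ^ 3 = (72 * M * \<alpha> ^ 3) * A' ^ 3" by (simp add: a_def power_mult_distrib)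
  also have "\<dots> = A'\<^sup>2 * (((1 - \<alpha>) * A') * ?\<Gamma>)"
    unfolding \<alpha>(3) by (simp add: power2_eq_square power3_eq_cube)
  also have "\<dots> = A'\<^sup>2 * \<Gamma>0" by (simp only: A' A\<Gamma>)
  finally have "72 * M * a ^ 3 = A'\<^sup>2 * \<Gamma>0" .
  moreover have "0 \<le> M * a ^ 3" using pos a by simp
  ultimately have a3: "18 * M * a ^ 3 \<le> A'\<^sup>2 * \<Gamma>0" by linarith
  have acc: "2 / (9 * sqrt M) * norm (g w) powr (3/2) \<le> g w \<bullet> (v - w)"
    using ok by (simp add: main_ok_def Let_def accepted_def M_def v_def w_def)
  have bound: "A' * f w \<le> \<psi> x" for x
  proof -
    have v: "A' *\<^sub>R v = ?A *\<^sub>R w_st st + a *\<^sub>R z_st st"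
      unfolding A'(2)[symmetric] v_def trial_v_def \<alpha>_def[symmetric] a_def
      by (simp add: scaleR_add_right mult.commute)
    have "?A *\<^sub>R (w_st st - w) + a *\<^sub>R (x - w) = A' *\<^sub>R (v - w) + a *\<^sub>R (x - z_st st)"
      unfolding scaleR_diff_right v unfolding a(2)[symmetric] by (simp add: scaleR_add_left)
    then have "g w \<bullet> (?A *\<^sub>R (w_st st - w) + a *\<^sub>R (x - w))
        = g w \<bullet> (A' *\<^sub>R (v - w) + a *\<^sub>R (x - z_st st))" by simp
    then have lin: "?A * (g w \<bullet> (w_st st - w)) + a * (g w \<bullet> (x - w))
        = A' * (g w \<bullet> (v - w)) + a * (g w \<bullet> (x - z_st st))"
      by (simp only: inner_add_right inner_scaleR_right)
    have "?A * (f w + g w \<bullet> (w_st st - w)) \<le> ?A * f (w_st st)"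
      using gradient_ineq pos by (intro mult_left_mono) auto
    moreover have "A' * (2 / (9 * sqrt M) * norm (g w) powr (3/2)) \<le> A' * (g w \<bullet> (v - w))"
      using acc A' by (intro mult_left_mono) auto
    moreover have "a * norm (g w) * norm (x - z_st st)
        \<le> A' * (2 / (9 * sqrt M) * norm (g w) powr (3/2)) + \<Gamma>0 / 6 * norm (x - z_st st) ^ 3"
      by (rule estimate_step_ineq) (use a A' \<Gamma>0_pos pos a3 in auto)
    moreover have "- (a * norm (g w) * norm (x - z_st st)) \<le> a * (g w \<bullet> (x - z_st st))"
    proof -
      have "a * - (g w \<bullet> (x - z_st st)) \<le> a * (norm (g w) * norm (x - z_st st))"
        using norm_cauchy_schwarz[of "g w" "z_st st - x"] a
        by (intro mult_left_mono) (auto simp: norm_minus_commute inner_diff_right)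
      then show ?thesis by simp
    qed
    moreover have "?A * f w + a * f w = A' * f w" by (simp flip: a(2) add: distrib_right)
    ultimately show ?thesis
      using lower0[of x] lin unfolding \<psi>_def distrib_left by linarith
  qed
  obtain k p where kp: "psi_st st = (\<lambda>x. k + p \<bullet> (x - x0) + \<Gamma>0 / 3 * norm (x - x0) ^ 3)"
    using inv by (auto simp: invariant_def)
  have form: "\<psi> = (\<lambda>x. (k + a * f w + a * (g w \<bullet> (x0 - w))) + (p + a *\<^sub>R g w) \<bullet> (x - x0)
      + \<Gamma>0 / 3 * norm (x - x0) ^ 3)"
    by (auto simp: \<psi>_def kp fun_eq_iff inner_add_left inner_diff_right algebra_simps)
  have lower: "A' * f w + \<Gamma>0 / 6 * norm (x - z) ^ 3 \<le> \<psi> x" for x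
  proof -
    have "\<psi> z + \<Gamma>0 / 6 * norm (x - z) ^ 3 \<le> \<psi> x"
      using linear_cube_model_growth[where c = "\<Gamma>0 / 3" and x = x
          and k = "k + a * f w + a * (g w \<bullet> (x0 - w))" and p = "p + a *\<^sub>R g w" and ?x0.0 = x0]
        \<Gamma>0_pos
      unfolding z_def form by simp
    with bound[of z] show ?thesis by linarith
  qed
  have upper: "\<psi> x \<le> (A' - 1) * f x + f x0 + \<Gamma>0 / 3 * norm (x - x0) ^ 3" for x
  proof -
    have "a * (f w + g w \<bullet> (x - w)) \<le> a * f x"
      using gradient_ineq a by (intro mult_left_mono) auto
    moreover have "psi_st st x \<le> (?A - 1) * f x + f x0 + \<Gamma>0 / 3 * norm (x - x0) ^ 3"
      using inv by (auto simp: invariant_def)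
    moreover have "(A' - 1) * f x = (?A - 1) * f x + a * f x"
      by (simp flip: a(2) add: algebra_simps)
    ultimately show ?thesis unfolding \<psi>_def by linarith
  qed
  have "A' * ((1 - \<alpha>) * ?\<Gamma>) = \<Gamma>0"
    using A' A\<Gamma> by (metis mult.assoc mult.commute)
  then show ?thesis
    unfolding invariant_def next_eq using \<alpha> pos A' lower upper form by auto
qed

text \<open>
  Evaluating the estimating function at the minimizer of \<open>f\<close>. The gap of \<open>w\<close> and the distance of \<open>z\<close>
  from the minimizer share one budget, so they cannot both be extremal.
\<close>
lemma invariant_gap:
  assumes "invariant st"
  shows "(f (w_st st) - f xstar) + Gamma_st st / 6 * norm (xstar - z_st st) ^ 3
    \<le> 2 / 3 * (Gamma_st st * R ^ 3)"
proof -
  let ?A = "A_st st" and ?\<Gamma> = "Gamma_st st"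
  have A: "0 < ?A" "?A * ?\<Gamma> = \<Gamma>0" using assms by (auto simp: invariant_def)
  have "?A * f (w_st st) + \<Gamma>0 / 6 * norm (xstar - z_st st) ^ 3
      \<le> (?A - 1) * f xstar + f x0 + \<Gamma>0 / 3 * norm (xstar - x0) ^ 3"
    using assms unfolding invariant_def by (blast intro: order_trans)
  also have "norm (xstar - x0) = R" by (simp add: R norm_minus_commute)
  finally have "?A * ((f (w_st st) - f xstar) + ?\<Gamma> / 6 * norm (xstar - z_st st) ^ 3)
      \<le> ?A * (2 / 3 * (?\<Gamma> * R ^ 3))"
    using initial_gap_le_\<Gamma>0 unfolding A(2)[symmetric] by (simp add: algebra_simps)
  then show ?thesis using A(1) by simp
qed

definition B :: real where
  "B = max (12 * sqrt 2 * M1 powr (3/2) * R ^ 3) (2 * R ^ 3 / (9 * \<rho> ^ 3))"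

text \<open>
  The radius is \<open>min \<rho> (1 / (4 * sqrt M1))\<close>, the second argument being infinite for \<open>M1 = 0\<close>. Each of
  the two terms in \<open>B\<close> gives the last inequality in one of the two cases of this minimum.
\<close>
lemma trust_radius:
  obtains b where "0 < b" "b \<le> \<rho>" "M1 * b\<^sup>2 \<le> 1 / 16" "2 / 9 * R ^ 3 \<le> B * b ^ 3"
proof (cases "M1 * \<rho>\<^sup>2 \<le> 1 / 16")
  case True
  have "2 / 9 * R ^ 3 = 2 * R ^ 3 / (9 * \<rho> ^ 3) * \<rho> ^ 3" using \<rho> by simp
  also have "\<dots> \<le> B * \<rho> ^ 3" unfolding B_def using \<rho> by (intro mult_right_mono) auto
  finally show ?thesis using that[of \<rho>] True \<rho> by simp
next
  case False
  then have M1: "0 < M1" using M1 by (cases "M1 = 0") auto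
  define b where "b = 1 / (4 * sqrt M1)"
  have b: "0 < b" using M1 by (simp add: b_def)
  have b2: "M1 * b\<^sup>2 = 1 / 16" using M1 by (simp add: b_def power_divide power_mult_distrib)
  then have "M1 * b\<^sup>2 \<le> M1 * \<rho>\<^sup>2" using False by simp
  then have "b \<le> \<rho>" using M1 \<rho> by (intro power2_le_imp_le[of b \<rho>]) auto
  have "M1 powr (3/2) = M1 * sqrt M1"
    using powr_add[of M1 1 "1/2"] M1 by (simp add: powr_half_sqrt)
  then have "M1 powr (3/2) * b ^ 3 = (M1 * b\<^sup>2) * (sqrt M1 * b)"
    by (simp add: power2_eq_square power3_eq_cube)
  moreover have "sqrt M1 * b = 1 / 4" using M1 by (simp add: b_def)
  ultimately have M1b: "M1 powr (3/2) * b ^ 3 = 1 / 64" by (simp only: b2)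
  have "(32 / 27)\<^sup>2 \<le> (2::real)" by (simp add: power2_eq_square)
  then have "32 / 27 \<le> sqrt 2" by (rule real_le_rsqrt)
  then have "2 / 9 * R ^ 3 \<le> 12 * sqrt 2 * (1 / 64) * R ^ 3"
    using R_pos by (intro mult_right_mono) auto
  also have "\<dots> = (12 * sqrt 2 * M1 powr (3/2) * R ^ 3) * b ^ 3"
    unfolding M1b[symmetric] by (simp add: mult_ac)
  also have "\<dots> \<le> B * b ^ 3" unfolding B_def using b by (intro mult_right_mono) auto
  finally show ?thesis using that[of b] b b2 \<open>b \<le> \<rho>\<close> by simp
qed

text \<open>
  The almost optimal point required by \<open>accepted_if_near_almost_optimal\<close> is
  \<open>(1 - \<alpha>) *\<^sub>R w + \<alpha> *\<^sub>R xstar\<close>: by convexity its gap is at most that of \<open>w\<close>, and its distance from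
  \<open>v = (1 - \<alpha>) *\<^sub>R w + \<alpha> *\<^sub>R z\<close> is \<open>\<alpha> * norm (xstar - z)\<close>, which the equation for \<open>\<alpha>\<close> and
  \<open>invariant_gap\<close> make small.
\<close>
lemma main_accepted:
  assumes inv: "invariant st" and M: "0 < M" "B * Gamma_st st \<le> M"
    and M0_le: "4 * M0 \<le> M \<or> M0 * (Gamma_st st * R ^ 3) \<le> 3 / 4 * (f (w_st st) - f xstar) * M"
  shows "accepted g M (trial_v st M) (trial_w g H st M)"
proof -
  let ?\<Gamma> = "Gamma_st st" and ?\<zeta> = "norm (xstar - z_st st)"
  define \<Delta> where "\<Delta> = f (w_st st) - f xstar"
  define \<alpha> where "\<alpha> = trial_alpha st M"
  have \<Gamma>: "0 < ?\<Gamma>" using inv by (simp add: invariant_def)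
  have \<alpha>: "0 < \<alpha>" "\<alpha> < 1" "72 * M * \<alpha> ^ 3 = (1 - \<alpha>) * ?\<Gamma>"
    unfolding \<alpha>_def using trial_alpha \<Gamma> M by blast+
  obtain b where b: "0 < b" "b \<le> \<rho>" "M1 * b\<^sup>2 \<le> 1 / 16" "2 / 9 * R ^ 3 \<le> B * b ^ 3"
    by (rule trust_radius)
  have "2 / 9 * (?\<Gamma> * R ^ 3) \<le> ?\<Gamma> * (B * b ^ 3)"
    using mult_left_mono[OF b(4), of ?\<Gamma>] \<Gamma> by (simp add: mult_ac)
  also have "\<dots> \<le> M * b ^ 3" using mult_right_mono[OF M(2), of "b ^ 3"] b by (simp add: mult_ac)
  finally have Mb: "2 / 9 * (?\<Gamma> * R ^ 3) \<le> M * b ^ 3" .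
  have gap: "\<Delta> + ?\<Gamma> / 6 * ?\<zeta> ^ 3 \<le> 2 / 3 * (?\<Gamma> * R ^ 3)" unfolding \<Delta>_def by (rule invariant_gap[OF inv])
  have \<Delta>: "0 \<le> \<Delta>" using minimizer by (simp add: \<Delta>_def)
  define y where "y = (1 - \<alpha>) *\<^sub>R w_st st + \<alpha> *\<^sub>R xstar"
  have "y - trial_v st M = \<alpha> *\<^sub>R (xstar - z_st st)"
    by (simp add: y_def trial_v_def \<alpha>_def[symmetric] scaleR_diff_right)
  then have D: "norm (y - trial_v st M) = \<alpha> * ?\<zeta>" using \<alpha> by simp
  have "72 * M * (\<alpha> * ?\<zeta>) ^ 3 = (72 * M * \<alpha> ^ 3) * ?\<zeta> ^ 3" by (simp add: power_mult_distrib)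
  also have "\<dots> = (1 - \<alpha>) * (?\<Gamma> * ?\<zeta> ^ 3)" unfolding \<alpha>(3) by simp
  also have "\<dots> \<le> 1 * (?\<Gamma> * ?\<zeta> ^ 3)" using \<alpha> \<Gamma> by (intro mult_right_mono) auto
  finally have D3: "72 * (M * (\<alpha> * ?\<zeta>) ^ 3) \<le> ?\<Gamma> * ?\<zeta> ^ 3" by (simp add: mult.assoc)
  have fy: "f y - f x \<le> \<Delta>" for x
  proof -
    have "f y \<le> (1 - \<alpha>) * f (w_st st) + \<alpha> * f xstar"
      unfolding y_def using \<alpha> by (intro convex_onD[OF convex]) auto
    also have "\<dots> = f (w_st st) - \<alpha> * \<Delta>" by (simp add: \<Delta>_def algebra_simps)
    also have "\<dots> \<le> f (w_st st)" using \<alpha> \<Delta> by simp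
    finally show ?thesis using minimizer[of x] by (simp add: \<Delta>_def)
  qed
  have "accepted g M (trial_v st M) (trial_v st M + cubic_step g H M (trial_v st M))"
  proof (rule accepted_if_near_almost_optimal[OF smooth M0 M1 M(1) b(1-3)])
    show "f y - f x + 12 * M * norm (y - trial_v st M) ^ 3 \<le> 3 * M * b ^ 3" for x
      unfolding D using fy[of x] D3 gap Mb by simp
    show "4 * M0 \<le> M \<or> M0 * b ^ 3 + 2 * M * norm (y - trial_v st M) ^ 3 \<le> M / 2 * b ^ 3"
    proof (use M0_le[folded \<Delta>_def] in \<open>elim disjE\<close>)
      assume le: "M0 * (?\<Gamma> * R ^ 3) \<le> 3 / 4 * \<Delta> * M"
      define X where "X = ?\<Gamma> * R ^ 3"
      have X: "0 < X" using \<Gamma> R_pos by (simp add: X_def)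
      have "X * (M0 * b ^ 3 + 2 * M * norm (y - trial_v st M) ^ 3)
          = M0 * X * b ^ 3 + X / 36 * (72 * (M * (\<alpha> * ?\<zeta>) ^ 3))"
        unfolding D by (simp add: algebra_simps)
      also have "\<dots> \<le> 3 / 4 * \<Delta> * M * b ^ 3 + X / 36 * (4 * X - 6 * \<Delta>)"
        using le b X D3 gap unfolding X_def[symmetric]
        by (intro add_mono mult_right_mono mult_left_mono) auto
      also have "X / 36 * (4 * X - 6 * \<Delta>) \<le> (M * b ^ 3) / 8 * (4 * X - 6 * \<Delta>)"
      proof (rule mult_right_mono)
        show "X / 36 \<le> M * b ^ 3 / 8" using Mb unfolding X_def[symmetric] by simp
        have "0 \<le> ?\<Gamma> / 6 * ?\<zeta> ^ 3" using \<Gamma> by simp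
        with gap show "0 \<le> 4 * X - 6 * \<Delta>" unfolding X_def[symmetric] by argo
      qed
      also have "3 / 4 * \<Delta> * M * b ^ 3 + (M * b ^ 3) / 8 * (4 * X - 6 * \<Delta>) = X * (M / 2 * b ^ 3)"
        by (simp add: field_simps)
      finally have "X * (M0 * b ^ 3 + 2 * M * norm (y - trial_v st M) ^ 3) \<le> X * (M / 2 * b ^ 3)"
        by simp
      then show ?thesis using X by simp
    qed simp
  qed
  then show ?thesis by (simp add: trial_w_def)
qed

end

section \<open>Rejections and iterations\<close>

lemma int_le_ceiling_log2:
  fixes X :: real
  assumes "J = 0 \<or> 2 ^ J < 2 * X"
  shows "int J \<le> \<lceil>log 2 (max 1 X)\<rceil>"
proof (cases J)
  case 0
  have "0 \<le> log 2 (max 1 X)" by simp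
  then have "0 \<le> \<lceil>log 2 (max 1 X)\<rceil>" by (metis ceiling_mono ceiling_zero)
  with 0 show ?thesis by simp
next
  case (Suc j)
  then have "2 ^ j < max 1 X" using assms by auto
  then have "real j < log 2 (max 1 X)" by (intro less_log_of_power) auto
  then show ?thesis using Suc by linarith
qed

lemma one_le_mult_cube_root:
  fixes x Q :: real
  assumes "1 \<le> x ^ 3 * Q" "0 < x" "0 < Q"
  shows "1 \<le> x * Q powr (1/3)"
proof (rule ccontr)
  assume "\<not> 1 \<le> x * Q powr (1/3)"
  then have "(x * Q powr (1/3)) ^ 3 < 1 ^ 3" using assms by (intro power_strict_mono) auto
  moreover have "(Q powr (1/3)) ^ 3 = Q"
    using assms by (simp add: powr_power)
  ultimately show False using assms by (simp add: power_mult_distrib)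
qed

lemma cube_root_divide: "(x / y) powr (1/3) = x powr (1/3) * y powr (-1/3)" for x y :: real
proof -
  have "y powr (-1/3) = inverse (y powr (1/3))"
    unfolding minus_divide_left[symmetric] by (rule powr_minus)
  then show ?thesis by (simp add: powr_divide divide_inverse[of "x powr (1/3)"])
qed

text \<open>
  Bernoulli's inequality for the exponent \<open>-1/3\<close>, obtained from \<open>1 + x \<le> exp x\<close>.
\<close>
lemma powr_contraction_ge:
  fixes \<alpha> \<Gamma> :: real
  assumes "0 < \<alpha>" "\<alpha> < 1" "0 < \<Gamma>"
  shows "\<Gamma> powr (-1/3) + \<alpha> / 3 * \<Gamma> powr (-1/3) \<le> ((1 - \<alpha>) * \<Gamma>) powr (-1/3)"
proof -
  have "ln (1 - \<alpha>) \<le> - \<alpha>" using ln_le_minus_one[of "1 - \<alpha>"] assms by simp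
  then have "1 + \<alpha> / 3 \<le> 1 + (-1/3) * ln (1 - \<alpha>)" by simp
  also have "\<dots> \<le> exp ((-1/3) * ln (1 - \<alpha>))" by (rule exp_ge_add_one_self)
  also have "\<dots> = (1 - \<alpha>) powr (-1/3)" using assms by (simp add: powr_def)
  finally have "(1 + \<alpha> / 3) * \<Gamma> powr (-1/3) \<le> (1 - \<alpha>) powr (-1/3) * \<Gamma> powr (-1/3)"
    by (rule mult_right_mono) simp
  moreover have "((1 - \<alpha>) * \<Gamma>) powr (-1/3) = (1 - \<alpha>) powr (-1/3) * \<Gamma> powr (-1/3)"
    by (rule powr_mult)
  ultimately show ?thesis by (simp add: distrib_right)
qed

definition log_arg :: "real \<Rightarrow> real \<Rightarrow> real \<Rightarrow> real \<Rightarrow> real \<Rightarrow> real \<Rightarrow> real \<Rightarrow> real" where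
  "log_arg M0 M1 Mt0 R G \<epsilon> \<tau> =
     2 + M0 * R ^ 3 / \<epsilon> + M1 * R\<^sup>2 + Mt0 * R ^ 3 / \<epsilon> + G * R / \<epsilon> + G / (Mt0 * R\<^sup>2) + \<tau>"

lemma log_factor_ge:
  assumes "0 \<le> M0" "0 \<le> M1" "0 \<le> Mt0" "0 \<le> R" "0 \<le> G" "0 < \<epsilon>" "0 \<le> \<tau>"
  shows "1 / 2 \<le> log_factor M0 M1 Mt0 R G \<epsilon> \<tau>"
proof -
  have S: "2 \<le> log_arg M0 M1 Mt0 R G \<epsilon> \<tau>"
    using assms by (simp add: log_arg_def add_nonneg_nonneg)
  have "1 / 2 \<le> ln (2::real)" using ln_le_minus_one[of "1/2::real"] by (simp add: ln_div)
  also have "\<dots> \<le> ln (log_arg M0 M1 Mt0 R G \<epsilon> \<tau>)" using S by simp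
  finally show ?thesis by (simp add: log_factor_def log_arg_def)
qed

context acr
begin

abbreviation St :: "nat \<Rightarrow> 'a acr_data" where "St \<equiv> acr_state f g H x0 Mt0"
abbreviation gap :: "nat \<Rightarrow> real" where "gap k \<equiv> f (w_st (St k)) - f xstar"
abbreviation J :: "nat \<Rightarrow> nat" where "J \<equiv> total_main_rejections f g H x0 Mt0"
abbreviation \<Gamma> :: "nat \<Rightarrow> real" where "\<Gamma> k \<equiv> Gamma_st (St k)"

lemma main_loop:
  assumes inv: "invariant st"
  shows "main_ok g H st (main_rejections g H st)"
    and "main_rejections g H st \<noteq> 0 \<Longrightarrow>
      2 ^ main_rejections g H st * reg_st st < 2 * max (B * Gamma_st st) (4 * M0)"
proof -
  let ?T = "max (B * Gamma_st st) (4 * M0)"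
  have reg: "0 < reg_st st" using inv by (simp add: invariant_def)
  have ok: "main_ok g H st i" if "?T \<le> 2 ^ i * reg_st st" for i
    unfolding main_ok_def Let_def using that reg by (intro main_accepted[OF inv]) auto
  show "main_ok g H st (main_rejections g H st)"
    unfolding main_rejections_def using reg ok by (rule backtracking_terminates(1))
  show "2 ^ main_rejections g H st * reg_st st < 2 * ?T" if "main_rejections g H st \<noteq> 0"
    using backtracking_terminates(2)[where P = "main_ok g H st" and T = ?T, OF reg ok] that
    unfolding main_rejections_def by blast
qed

lemma invariant_St: "invariant (St k)"
  by (induction k) (use invariant_init main_loop(1) in \<open>auto intro: invariant_step\<close>)

lemma loops_terminate: "loops_terminate f g H x0 Mt0"
  using init_terminates main_loop(1)[OF invariant_St] unfolding loops_terminate_def by blast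

lemma \<Gamma>_pos: "0 < \<Gamma> k"
  using invariant_St[of k] by (simp add: invariant_def)

text \<open>
  The rescaling of the regularization coefficient at the end of an iteration keeps its quotient by
  \<open>\<Gamma>\<close>, so the quotient counts all rejections since the start.
\<close>
lemma reg_eq: "reg_st (St k) = 2 ^ J k * \<Gamma> k"
proof (induction k)
  case 0
  then show ?case by (simp add: init_state_def Let_def total_main_rejections_def)
next
  case (Suc k)
  show ?case
    using Suc \<Gamma>_pos[of k]
    by (simp add: next_state_def Let_def total_main_rejections_def power_add)
qed

lemma accepted_reg_eq: "2 ^ main_rejections g H (St k) * reg_st (St k) = 2 ^ J (Suc k) * \<Gamma> k"
  by (simp add: reg_eq total_main_rejections_def power_add)

lemma \<Gamma>_Suc:
  obtains \<alpha> where "0 < \<alpha>" "\<alpha> < 1" "\<Gamma> (Suc k) = (1 - \<alpha>) * \<Gamma> k" "72 * 2 ^ J (Suc k) * \<alpha> ^ 3 = 1 - \<alpha>"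
proof -
  define M where "M = 2 ^ main_rejections g H (St k) * reg_st (St k)"
  have M: "M = 2 ^ J (Suc k) * \<Gamma> k" unfolding M_def by (rule accepted_reg_eq)
  have "0 < M" using \<Gamma>_pos[of k] by (simp add: M)
  note \<alpha> = trial_alpha[OF \<Gamma>_pos[of k] this]
  have "\<Gamma> k * (72 * 2 ^ J (Suc k) * trial_alpha (St k) M ^ 3) = \<Gamma> k * (1 - trial_alpha (St k) M)"
    using \<alpha>(3) unfolding M[symmetric] by (simp add: M mult_ac)
  then have "72 * 2 ^ J (Suc k) * trial_alpha (St k) M ^ 3 = 1 - trial_alpha (St k) M"
    using \<Gamma>_pos[of k] by simp
  moreover have "\<Gamma> (Suc k) = (1 - trial_alpha (St k) M) * \<Gamma> k"
    by (simp add: next_state_def Let_def M_def)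
  ultimately show ?thesis using \<alpha> that by blast
qed

lemma \<Gamma>_Suc_le: "\<Gamma> (Suc k) \<le> \<Gamma> k"
proof -
  obtain \<alpha> where \<alpha>: "0 < \<alpha>" "\<alpha> < 1" "\<Gamma> (Suc k) = (1 - \<alpha>) * \<Gamma> k" by (rule \<Gamma>_Suc)
  then show ?thesis using \<Gamma>_pos[of k] unfolding \<alpha>(3) by (intro mult_left_le_one_le) auto
qed

lemma rejections_if_rejected:
  assumes "main_rejections g H (St k) \<noteq> 0"
  shows "2 ^ J (Suc k) < 2 * max B (4 * M0 / \<Gamma> k)"
proof -
  have "2 ^ main_rejections g H (St k) * reg_st (St k) < 2 * max (B * \<Gamma> k) (4 * M0)"
    by (rule main_loop(2)[OF invariant_St assms])
  also have "\<dots> = (2 * max B (4 * M0 / \<Gamma> k)) * \<Gamma> k"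
    using \<Gamma>_pos[of k] by (simp add: max_mult_distrib_right)
  finally show ?thesis
    using \<Gamma>_pos[of k] by (simp only: accepted_reg_eq mult_less_cancel_right_pos)
qed

text \<open>
  The threshold depends on the iteration only through \<open>\<Gamma>\<close>, which decreases, so that the estimate from the
  last rejection remains valid.
\<close>
lemma rejections_so_far:
  "J (Suc k) = 0 \<or> 2 ^ J (Suc k) < 2 * max B (4 * M0 / \<Gamma> k)"
proof (induction k)
  case (Suc k)
  show ?case
  proof (cases "main_rejections g H (St (Suc k)) = 0")
    case True
    then have J: "J (Suc (Suc k)) = J (Suc k)" by (simp add: total_main_rejections_def)
    have "4 * M0 / \<Gamma> k \<le> 4 * M0 / \<Gamma> (Suc k)"
      using \<Gamma>_Suc_le[of k] \<Gamma>_pos[of "Suc k"] M0 by (intro divide_left_mono) auto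
    then show ?thesis using Suc unfolding J by (auto simp: max_def split: if_splits)
  qed (use rejections_if_rejected in blast)
next
  case 0
  show ?case
    using rejections_if_rejected[of 0]
    by (cases "main_rejections g H (St 0) = 0") (simp_all add: total_main_rejections_def)
qed

text \<open>
  While the gap exceeds \<open>\<epsilon>\<close>, the alternative condition of \<open>main_accepted\<close> on \<open>M0\<close> holds as soon as
  \<open>M / \<Gamma> k\<close> exceeds \<open>4 * M0 * R ^ 3 / (3 * \<epsilon>)\<close>, a threshold common to all iterations.
\<close>
lemma total_rejections:
  assumes \<epsilon>: "0 < \<epsilon>" and gap: "\<And>k. k < N \<Longrightarrow> \<epsilon> < gap k"
  shows "J N = 0 \<or> 2 ^ J N < 2 * max B (4 * M0 * R ^ 3 / (3 * \<epsilon>))"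
  using gap
proof (induction N)
  case 0
  then show ?case by (simp add: total_main_rejections_def)
next
  case (Suc n)
  let ?C = "4 * M0 * R ^ 3 / (3 * \<epsilon>)"
  show ?case
  proof (cases "main_rejections g H (St n) = 0")
    case True
    then have "J (Suc n) = J n" by (simp add: total_main_rejections_def)
    with Suc show ?thesis by simp
  next
    case False
    have reg: "0 < reg_st (St n)" using invariant_St[of n] by (simp add: invariant_def)
    have ok: "main_ok g H (St n) i" if le: "max B ?C * \<Gamma> n \<le> 2 ^ i * reg_st (St n)" for i
    proof -
      define M where "M = 2 ^ i * reg_st (St n)"
      have M: "0 < M" using reg by (simp add: M_def)
      have "B * \<Gamma> n \<le> M" "?C * \<Gamma> n \<le> M"
        using le \<Gamma>_pos[of n] unfolding M_def by (auto simp: max_mult_distrib_right)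
      then have "M0 * (\<Gamma> n * R ^ 3) \<le> 3 / 4 * \<epsilon> * M" using \<epsilon> by (simp add: field_simps)
      also have "\<dots> \<le> 3 / 4 * gap n * M"
        using Suc.prems[of n] M by (intro mult_right_mono mult_left_mono) auto
      finally have "accepted g M (trial_v (St n) M) (trial_w g H (St n) M)"
        using M \<open>B * \<Gamma> n \<le> M\<close> by (intro main_accepted[OF invariant_St]) auto
      then show ?thesis by (simp add: main_ok_def Let_def M_def)
    qed
    have "2 ^ main_rejections g H (St n) * reg_st (St n) < 2 * (max B ?C * \<Gamma> n)"
      using backtracking_terminates(2)[where P = "main_ok g H (St n)" and T = "max B ?C * \<Gamma> n", OF reg ok]
        False unfolding main_rejections_def by blast
    then have "2 ^ J (Suc n) * \<Gamma> n < (2 * max B ?C) * \<Gamma> n"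
      unfolding accepted_reg_eq by (simp only: mult.assoc)
    then have "2 ^ J (Suc n) < 2 * max B ?C"
      using \<Gamma>_pos[of n] by (simp only: mult_less_cancel_right_pos)
    then show ?thesis ..
  qed
qed

text \<open>
  An iteration in which the threshold \<open>4 * M0\<close> dominates increases \<open>\<Gamma> powr (-1/3)\<close> by at least
  a constant amount; one in which \<open>max 1 B\<close> dominates shrinks \<open>\<Gamma>\<close> at least by a constant factor. Both quantities are
  monotone, so their weighted sum measures progress whatever the order of the two kinds of
  iterations. This keeps the logarithm away from the term with \<open>M0\<close>.
\<close>
definition potential :: "nat \<Rightarrow> real" where
  "potential k = 18 * (4 * M0) powr (1/3) * \<Gamma> k powr (-1/3) - 6 * (max 1 B) powr (1/3) * ln (\<Gamma> k)"

lemma potential_increase: "potential k + 1 \<le> potential (Suc k)"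
proof -
  obtain \<alpha> where \<alpha>: "0 < \<alpha>" "\<alpha> < 1" "\<Gamma> (Suc k) = (1 - \<alpha>) * \<Gamma> k" "72 * 2 ^ J (Suc k) * \<alpha> ^ 3 = 1 - \<alpha>"
    by (rule \<Gamma>_Suc)
  let ?u = "\<Gamma> k powr (-1/3)" and ?b = "(max 1 B) powr (1/3)" and ?c = "(4 * M0) powr (1/3)"
  have u_inc: "?u + \<alpha> / 3 * ?u \<le> \<Gamma> (Suc k) powr (-1/3)"
    unfolding \<alpha>(3) using \<alpha> \<Gamma>_pos by (intro powr_contraction_ge) auto
  have "ln (\<Gamma> (Suc k)) = ln (1 - \<alpha>) + ln (\<Gamma> k)"
    unfolding \<alpha>(3) using \<alpha> \<Gamma>_pos[of k] by (simp add: ln_mult)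
  then have ln_dec: "ln (\<Gamma> (Suc k)) \<le> ln (\<Gamma> k) - \<alpha>"
    using ln_le_minus_one[of "1 - \<alpha>"] \<alpha> by simp
  define Q where "Q = max (max 1 B) (4 * M0 / \<Gamma> k)"
  have Q: "1 \<le> Q" "2 ^ J (Suc k) \<le> 2 * Q"
    using rejections_so_far[of k] by (auto simp: Q_def max_def split: if_splits)
  \<comment> \<open>As \<open>2 ^ J \<ge> 1\<close>, the equation for \<open>\<alpha>\<close> gives \<open>\<alpha> \<le> 1/4\<close>, hence \<open>3/4 \<le> 144 * Q * \<alpha> ^ 3\<close>.\<close>
  have "1 \<le> (6 * \<alpha>) ^ 3 * Q"
  proof -
    have "72 * \<alpha> ^ 3 \<le> 72 * 2 ^ J (Suc k) * \<alpha> ^ 3"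
      using \<alpha>(1) mult_right_mono[of 1 "2 ^ J (Suc k)" "\<alpha> ^ 3"] by simp
    also have "\<dots> \<le> 1" unfolding \<alpha>(4) using \<alpha>(1) by simp
    finally have "\<alpha> ^ 3 \<le> (1 / 4) ^ 3" by (simp add: power3_eq_cube)
    then have "\<alpha> \<le> 1 / 4" by (intro power_le_imp_le_base[of \<alpha> 2 "1/4"]) auto
    then have "3 / 4 \<le> 72 * 2 ^ J (Suc k) * \<alpha> ^ 3" unfolding \<alpha>(4) by simp
    also have "\<dots> \<le> 72 * (2 * Q) * \<alpha> ^ 3" using Q \<alpha>(1) by (intro mult_right_mono) auto
    finally have "3 / 4 \<le> 144 * (Q * \<alpha> ^ 3)" by simp
    moreover have "(6 * \<alpha>) ^ 3 * Q = 216 * (Q * \<alpha> ^ 3)" by (simp add: power3_eq_cube)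
    ultimately show ?thesis by argo
  qed
  then have one: "1 \<le> 6 * \<alpha> * Q powr (1/3)"
    using Q \<alpha> by (intro one_le_mult_cube_root) auto
  have "18 * ?c * (?u + \<alpha> / 3 * ?u) \<le> 18 * ?c * \<Gamma> (Suc k) powr (-1/3)"
    using u_inc by (intro mult_left_mono) auto
  moreover have "6 * ?b * ln (\<Gamma> (Suc k)) \<le> 6 * ?b * (ln (\<Gamma> k) - \<alpha>)"
    using ln_dec by (intro mult_left_mono) auto
  moreover have "1 \<le> 6 * \<alpha> * (?c * ?u) + 6 * \<alpha> * ?b"
  proof (cases "4 * M0 / \<Gamma> k \<le> max 1 B")
    case True
    then have "Q = max 1 B" by (simp add: Q_def)
    then have "1 \<le> 6 * \<alpha> * ?b" using one by simp
    moreover have "0 \<le> 6 * \<alpha> * (?c * ?u)" using \<alpha>(1) by simp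
    ultimately show ?thesis by linarith
  next
    case False
    then have "Q = 4 * M0 / \<Gamma> k" by (simp add: Q_def)
    then have "Q powr (1/3) = ?c * ?u" by (simp only: cube_root_divide)
    then have "1 \<le> 6 * \<alpha> * (?c * ?u)" using one by (simp only:)
    moreover have "0 \<le> 6 * \<alpha> * ?b" using \<alpha>(1) by simp
    ultimately show ?thesis by linarith
  qed
  moreover have "18 * ?c * (?u + \<alpha> / 3 * ?u) = 18 * ?c * ?u + 6 * \<alpha> * (?c * ?u)"
    "6 * ?b * (ln (\<Gamma> k) - \<alpha>) = 6 * ?b * ln (\<Gamma> k) - 6 * \<alpha> * ?b"
    by (simp_all add: algebra_simps)
  ultimately show ?thesis unfolding potential_def by argo
qed

lemma potential_ge: "potential 0 + real k \<le> potential k"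
proof (induction k)
  case (Suc k)
  then show ?case using potential_increase[of k] by simp
qed simp

text \<open>
  \<open>B\<close> is at most the cube of \<open>1 + 3 * sqrt M1 * R + R / \<rho>\<close>, because \<open>12 * sqrt 2 \<le> 3 ^ 3\<close>.
\<close>
lemma B_le: "max 1 B powr (1/3) \<le> 3 * (1 + sqrt M1 * R + R / \<rho>)"
proof -
  define Y where "Y = 1 + 3 * (sqrt M1 * R) + R / \<rho>"
  have nn: "0 \<le> sqrt M1 * R" "0 \<le> R / \<rho>" using M1 R_pos \<rho> by auto
  then have Y: "1 \<le> Y" "3 * (sqrt M1 * R) \<le> Y" "R / \<rho> \<le> Y"
    unfolding Y_def by linarith+
  have "sqrt 2 \<le> 9 / 4" by (rule real_le_lsqrt) (auto simp: power2_eq_square)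
  have "M1 powr (3/2) = sqrt M1 ^ 3"
    using powr_add[of M1 1 "1/2"] M1 by (simp add: powr_half_sqrt power3_eq_cube)
  then have "12 * sqrt 2 * M1 powr (3/2) * R ^ 3 = (12 * sqrt 2) * (sqrt M1 * R) ^ 3"
    by (simp add: power_mult_distrib)
  also have "\<dots> \<le> 27 * (sqrt M1 * R) ^ 3"
    using \<open>sqrt 2 \<le> 9 / 4\<close> nn by (intro mult_right_mono) auto
  also have "\<dots> = (3 * (sqrt M1 * R)) ^ 3" by (simp add: power_mult_distrib)
  also have "\<dots> \<le> Y ^ 3" using Y nn by (intro power_mono) auto
  finally have 1: "12 * sqrt 2 * M1 powr (3/2) * R ^ 3 \<le> Y ^ 3" .
  have "2 * R ^ 3 / (9 * \<rho> ^ 3) \<le> (R / \<rho>) ^ 3"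
    using R_pos \<rho> by (simp add: power_divide field_simps)
  also have "\<dots> \<le> Y ^ 3" using Y nn by (intro power_mono) auto
  finally have "2 * R ^ 3 / (9 * \<rho> ^ 3) \<le> Y ^ 3" .
  with 1 Y have "max 1 B \<le> Y ^ 3" by (simp add: B_def)
  then have "max 1 B powr (1/3) \<le> (Y ^ 3) powr (1/3)" by (intro powr_mono2) auto
  also have "\<dots> = Y" using Y by (simp flip: powr_numeral add: powr_powr)
  also have "\<dots> \<le> 3 * (1 + sqrt M1 * R + R / \<rho>)" using nn by (simp add: Y_def)
  finally show ?thesis .
qed

lemma Mt_bound:
  assumes \<epsilon>: "0 < \<epsilon>"
  defines "S \<equiv> log_arg M0 M1 Mt0 R (norm (g x0)) \<epsilon> (R / \<rho>)"
  shows "Mt * R ^ 3 / \<epsilon> \<le> 3 * S ^ 3"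
proof -
  let ?G = "norm (g x0)"
  have nn: "0 \<le> M0 * R ^ 3 / \<epsilon>" "0 \<le> M1 * R\<^sup>2" "0 \<le> Mt0 * R ^ 3 / \<epsilon>" "0 \<le> ?G * R / \<epsilon>"
    "0 \<le> ?G / (Mt0 * R\<^sup>2)" "0 \<le> R / \<rho>"
    using M0 M1 Mt0 R_pos \<epsilon> \<rho> by auto
  then have S: "2 \<le> S" "M0 * R ^ 3 / \<epsilon> \<le> S" "M1 * R\<^sup>2 \<le> S" "Mt0 * R ^ 3 / \<epsilon> \<le> S"
    "?G * R / \<epsilon> \<le> S" "R / \<rho> \<le> S"
    unfolding S_def log_arg_def by linarith+
  have S1: "S \<le> S ^ 2 / 2" using S(1) by (simp add: power2_eq_square)
  have S2: "S ^ 2 \<le> S ^ 3 / 2"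
    using mult_right_mono[OF S(1), of "S\<^sup>2"] by (simp add: power2_eq_square power3_eq_cube)
  have S0: "0 \<le> S ^ 3" using S(1) by simp
  have "Mt0 * R ^ 3 / \<epsilon> \<le> 3 * S ^ 3" using S(4) S1 S2 S0 by linarith
  moreover have "(2 * (M0 + 2 * M1 * ?G)) * R ^ 3 / \<epsilon> \<le> 3 * S ^ 3"
  proof -
    have "(2 * (M0 + 2 * M1 * ?G)) * R ^ 3 / \<epsilon>
        = 2 * (M0 * R ^ 3 / \<epsilon>) + 4 * ((M1 * R\<^sup>2) * (?G * R / \<epsilon>))"
      using \<epsilon> by (simp add: field_simps power2_eq_square power3_eq_cube)
    moreover have "(M1 * R\<^sup>2) * (?G * R / \<epsilon>) \<le> S * S"
      using S nn by (intro mult_mono) auto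
    ultimately show ?thesis using S(2) S1 S2 S0 by (simp add: power2_eq_square)
  qed
  moreover have "(2 * (2 * ?G / (15 * \<rho>\<^sup>2))) * R ^ 3 / \<epsilon> \<le> 3 * S ^ 3"
  proof -
    have "(2 * (2 * ?G / (15 * \<rho>\<^sup>2))) * R ^ 3 / \<epsilon> = 4 / 15 * ((?G * R / \<epsilon>) * (R / \<rho>)\<^sup>2)"
      using \<epsilon> \<rho> by (simp add: field_simps power2_eq_square power3_eq_cube)
    moreover have "(?G * R / \<epsilon>) * (R / \<rho>)\<^sup>2 \<le> S * S\<^sup>2"
      using S nn by (intro mult_mono power_mono) auto
    ultimately show ?thesis using S0 by (simp add: power2_eq_square power3_eq_cube)
  qed
  moreover have "Mt * R ^ 3 / \<epsilon> \<le> max Mt0 (2 * T0) * R ^ 3 / \<epsilon>"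
    using Mt_le \<epsilon> R_pos by (intro divide_right_mono mult_right_mono) auto
  ultimately show ?thesis
    by (auto simp: T0_def max_def split: if_splits)
qed

text \<open>
  Although \<open>\<Gamma>0\<close> contains the decrease \<open>D\<close> of the initialization step in its denominator, it is bounded
  by a power of the argument of the logarithm. If \<open>D \<ge> \<epsilon> / 2\<close>, this is immediate. Otherwise the gap
  at the new point exceeds \<open>\<epsilon> / 2\<close>, so by convexity the gradient there is not small, and the acceptance
  test bounds \<open>D\<close> from below in terms of that gradient.
\<close>
lemma \<Gamma>0_bound:
  assumes \<epsilon>: "0 < \<epsilon>" "\<epsilon> < f x0 - f xstar"
  defines "S \<equiv> log_arg M0 M1 Mt0 R (norm (g x0)) \<epsilon> (R / \<rho>)"
  shows "\<Gamma>0 * (2 * R ^ 3 / (3 * \<epsilon>)) \<le> S ^ 20"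
proof -
  let ?G = "norm (g x0)" and ?D = "f x0 - f xt"
  have nn: "0 \<le> M0 * R ^ 3 / \<epsilon>" "0 \<le> M1 * R\<^sup>2" "0 \<le> Mt0 * R ^ 3 / \<epsilon>" "0 \<le> ?G * R / \<epsilon>"
    "0 \<le> ?G / (Mt0 * R\<^sup>2)" "0 \<le> R / \<rho>"
    using M0 M1 Mt0 R_pos \<epsilon> \<rho> by auto
  then have S: "2 \<le> S" "?G * R / \<epsilon> \<le> S" "2 + ?G / (Mt0 * R\<^sup>2) \<le> S"
    unfolding S_def log_arg_def by linarith+
  have D: "0 < ?D" by (rule init_decrease_pos)
  have Mt: "0 < Mt" "Mt0 \<le> Mt" using Mt_ge Mt0 by auto
  have ratio: "\<epsilon>\<^sup>2 \<le> S ^ 16 * ?D\<^sup>2"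
  proof (cases "\<epsilon> / 2 \<le> ?D")
    case True
    then have "(\<epsilon> / 2)\<^sup>2 \<le> ?D\<^sup>2" using \<epsilon> by (intro power_mono) auto
    then have "\<epsilon>\<^sup>2 \<le> 2 ^ 2 * ?D\<^sup>2" by (simp add: power_divide)
    also have "\<dots> \<le> S ^ 2 * ?D\<^sup>2" using S by (intro mult_right_mono power_mono) auto
    also have "\<dots> \<le> S ^ 16 * ?D\<^sup>2" using S by (intro mult_right_mono power_increasing) auto
    finally show ?thesis .
  next
    case False
    let ?g = "norm (g xt)"
    define r q where "r = norm (xt - x0)" and "q = R + r"
    have q: "R \<le> q" "0 < q" using R_pos by (auto simp: q_def r_def intro: add_pos_nonneg)
    have "\<epsilon> / 2 < f xt - f xstar" using False \<epsilon> by simp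
    also have "\<dots> \<le> g xt \<bullet> (xt - xstar)"
      using gradient_ineq[of xt xstar] by (simp add: inner_diff_right)
    also have "\<dots> \<le> ?g * norm (xt - xstar)" by (rule norm_cauchy_schwarz)
    also have "\<dots> \<le> ?g * q"
      using norm_triangle_ineq[of "x0 - xstar" "xt - x0"]
      by (intro mult_left_mono) (auto simp: q_def r_def R)
    finally have "\<epsilon> / 2 \<le> ?g * q" by simp
    then have "(\<epsilon> / 2) ^ 3 \<le> (?g * q) ^ 3" using \<epsilon> by (intro power_mono) auto
    then have g3: "\<epsilon> ^ 3 \<le> 8 * (?g ^ 3 * q ^ 3)" by (simp add: power_divide power_mult_distrib)
    have "(?g powr (3/2))\<^sup>2 = ?g ^ 3"
      by (cases "?g = 0") (simp_all add: powr_power)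
    then have "4 * ?g ^ 3 / (81 * Mt) = (2 / (9 * sqrt Mt) * ?g powr (3/2))\<^sup>2"
      using Mt by (simp add: power_mult_distrib power_divide)
    also have "\<dots> \<le> ?D\<^sup>2" using init_decrease Mt by (intro power_mono) auto
    finally have D2: "4 * ?g ^ 3 \<le> 81 * Mt * ?D\<^sup>2" using Mt by (simp add: field_simps)
    have "\<epsilon> ^ 3 \<le> 2 * q ^ 3 * (4 * ?g ^ 3)" using g3 by (simp add: mult_ac)
    also have "\<dots> \<le> 2 * q ^ 3 * (81 * Mt * ?D\<^sup>2)" using q by (intro mult_left_mono D2) auto
    finally have eps3: "\<epsilon> ^ 3 \<le> 162 * (Mt * q ^ 3) * ?D\<^sup>2" by (simp add: mult_ac)
    have "15 / 2 * Mt * r\<^sup>2 \<le> ?G"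
      unfolding r_def xt_def init_point_def using cubic_step_le[OF Mt(1), of x0] by simp
    moreover have "Mt0 * r\<^sup>2 \<le> 15 / 2 * Mt * r\<^sup>2"
      using Mt Mt0 by (intro mult_right_mono) auto
    ultimately have "Mt0 * r\<^sup>2 \<le> ?G" by linarith
    then have r2: "r\<^sup>2 \<le> R\<^sup>2 * (?G / (Mt0 * R\<^sup>2))" using Mt0 R_pos by (simp add: field_simps)
    have "q\<^sup>2 \<le> 2 * (R\<^sup>2 + r\<^sup>2)"
      using sum_squares_bound[of R r] by (simp add: q_def power2_sum)
    also have "\<dots> \<le> 2 * (R\<^sup>2 * (1 + ?G / (Mt0 * R\<^sup>2)))" using r2 by (simp add: distrib_left)
    also have "\<dots> \<le> 2 * (R\<^sup>2 * S)" using S(3) by (intro mult_left_mono) auto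
    finally have "(q\<^sup>2)\<^sup>2 \<le> (2 * (R\<^sup>2 * S))\<^sup>2" by (intro power_mono) auto
    moreover have "R * q ^ 3 \<le> q * q ^ 3" using q by (intro mult_right_mono) auto
    ultimately have "R * q ^ 3 \<le> R * (4 * (R ^ 3 * S\<^sup>2))"
      by (simp add: power2_eq_square power3_eq_cube mult_ac)
    then have q3: "q ^ 3 \<le> 4 * (R ^ 3 * S\<^sup>2)" using R_pos by simp
    have "Mt * R ^ 3 \<le> 3 * S ^ 3 * \<epsilon>"
      using Mt_bound[OF \<epsilon>(1)] \<epsilon> unfolding S_def by (simp add: pos_divide_le_eq)
    then have MtR: "(Mt * R ^ 3) * (4 * S\<^sup>2) \<le> (3 * S ^ 3 * \<epsilon>) * (4 * S\<^sup>2)"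
      by (intro mult_right_mono) auto
    have "Mt * q ^ 3 \<le> Mt * (4 * (R ^ 3 * S\<^sup>2))" using q3 Mt by (intro mult_left_mono) auto
    also have "\<dots> \<le> (3 * S ^ 3 * \<epsilon>) * (4 * S\<^sup>2)" using MtR by (simp add: mult_ac)
    also have "\<dots> = 12 * S ^ 5 * \<epsilon>" by (simp add: power_numeral_reduce mult_ac)
    finally have "162 * (Mt * q ^ 3) \<le> 1944 * S ^ 5 * \<epsilon>" by argo
    also have "\<dots> \<le> S ^ 16 * \<epsilon>"
    proof -
      have "(2::real) ^ 11 \<le> S ^ 11" using S by (intro power_mono) auto
      then have "1944 * S ^ 5 \<le> S ^ 11 * S ^ 5" using S by (intro mult_right_mono) auto
      also have "\<dots> = S ^ 16" by (simp flip: power_add)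
      finally show ?thesis using \<epsilon> by (intro mult_right_mono) auto
    qed
    finally have "162 * (Mt * q ^ 3) * ?D\<^sup>2 \<le> S ^ 16 * \<epsilon> * ?D\<^sup>2" by (rule mult_right_mono) simp
    with eps3 have "\<epsilon> ^ 3 \<le> S ^ 16 * \<epsilon> * ?D\<^sup>2" by linarith
    then have "\<epsilon> * \<epsilon>\<^sup>2 \<le> \<epsilon> * (S ^ 16 * ?D\<^sup>2)"
      by (simp add: power2_eq_square power3_eq_cube mult_ac)
    then show ?thesis using \<epsilon> by simp
  qed
  have "\<Gamma>0 * (2 * R ^ 3 / (3 * \<epsilon>)) = 2 * (?G * R / \<epsilon>) ^ 3 * (\<epsilon>\<^sup>2 / ?D\<^sup>2)"
    unfolding \<Gamma>0_eq using \<epsilon> D by (simp add: field_simps power2_eq_square power3_eq_cube)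
  also have "\<dots> \<le> S * S ^ 3 * S ^ 16"
  proof (intro mult_mono)
    show "\<epsilon>\<^sup>2 / ?D\<^sup>2 \<le> S ^ 16" using ratio D by (simp add: pos_divide_le_eq)
  qed (use S nn in \<open>auto intro!: power_mono\<close>)
  also have "\<dots> = S ^ 20" by (simp flip: power_add power_Suc)
  finally show ?thesis .
qed

text \<open>
  Before accuracy \<open>\<epsilon>\<close> is reached, \<open>\<Gamma>\<close> stays above a multiple of \<open>\<epsilon> / R ^ 3\<close>, so the potential cannot
  have increased by more than the stated amount.
\<close>
lemma iteration_bound:
  assumes \<epsilon>: "0 < \<epsilon>" and gap: "\<And>k. k < N \<Longrightarrow> \<epsilon> < gap k"
  shows "real N \<le> big_O_const * (M0 * R ^ 3 / \<epsilon>) powr (1/3)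
    + big_O_const * (1 + sqrt M1 * R + R / \<rho>)
      * log_factor M0 M1 Mt0 R (norm (g x0)) \<epsilon> (R / \<rho>)"
proof (cases N)
  case 0
  have "0 \<le> log_factor M0 M1 Mt0 R (norm (g x0)) \<epsilon> (R / \<rho>)"
    using log_factor_ge[of M0 M1 Mt0 R "norm (g x0)" \<epsilon> "R / \<rho>"] M0 M1 Mt0 R_pos \<epsilon> \<rho> by simp
  with 0 show ?thesis
    using M0 M1 R_pos \<rho> \<epsilon> by (simp add: big_O_const_def add_nonneg_nonneg)
next
  case (Suc n)
  define S where "S = log_arg M0 M1 Mt0 R (norm (g x0)) \<epsilon> (R / \<rho>)"
  define L where "L = log_factor M0 M1 Mt0 R (norm (g x0)) \<epsilon> (R / \<rho>)"
  define \<gamma> where "\<gamma> = 3 * \<epsilon> / (2 * R ^ 3)"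
  define b c where "b = max 1 B powr (1/3)" and "c = (M0 * R ^ 3 / \<epsilon>) powr (1/3)"
  define W where "W = 1 + sqrt M1 * R + R / \<rho>"
  have L: "1 / 2 \<le> L" "L = ln S"
    unfolding L_def using log_factor_ge M0 M1 Mt0 R_pos \<epsilon> \<rho>
    by (auto simp: S_def log_factor_def log_arg_def)
  have W: "1 \<le> W" unfolding W_def using M1 R_pos \<rho> by (simp add: add_nonneg_nonneg)
  have bW: "0 \<le> b" "b \<le> 3 * W" using B_le by (auto simp: b_def W_def)
  have \<gamma>: "0 < \<gamma>" using \<epsilon> R_pos by (simp add: \<gamma>_def)
  have "0 \<le> \<Gamma> n / 6 * norm (xstar - z_st (St n)) ^ 3" using \<Gamma>_pos[of n] by simp
  then have "\<epsilon> \<le> 2 / 3 * (\<Gamma> n * R ^ 3)"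
    using invariant_gap[OF invariant_St[of n]] gap[of n] Suc by simp
  then have \<gamma>_le: "\<gamma> \<le> \<Gamma> n" using R_pos by (simp add: \<gamma>_def field_simps)
  have S0: "0 < S" using M0 M1 Mt0 R_pos \<epsilon> \<rho> by (simp add: S_def log_arg_def add_pos_nonneg)
  have \<Gamma>0: "\<Gamma> 0 = \<Gamma>0" by (simp add: init_state_def Let_def \<Gamma>0_def)
  have "\<Gamma>0 / \<gamma> \<le> S ^ 20"
    using \<Gamma>0_bound[OF \<epsilon>] gap[of 0] Suc by (simp add: S_def \<gamma>_def init_state_def Let_def)
  then have "ln (\<Gamma>0 / \<gamma>) \<le> ln (S ^ 20)" using \<Gamma>0_pos \<gamma> S0 by (intro ln_mono) auto
  then have ln_le: "ln \<Gamma>0 - ln \<gamma> \<le> 20 * L"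
    using \<Gamma>0_pos \<gamma> S0 L by (simp add: ln_div ln_realpow)
  have "potential 0 + real n \<le> potential n" by (rule potential_ge)
  moreover have "- (6 * b * ln \<Gamma>0) \<le> potential 0"
    unfolding potential_def \<Gamma>0 b_def[symmetric] by simp
  moreover have "potential n \<le> 36 * c - 6 * b * ln \<gamma>"
  proof -
    have "\<Gamma> n powr (-1/3) \<le> \<gamma> powr (-1/3)" using \<gamma> \<gamma>_le by (intro powr_mono2') auto
    then have "(4 * M0) powr (1/3) * \<Gamma> n powr (-1/3) \<le> (4 * M0) powr (1/3) * \<gamma> powr (-1/3)"
      by (intro mult_left_mono) auto
    also have "\<dots> = (4 * M0 / \<gamma>) powr (1/3)"
      by (simp only: cube_root_divide)
    also have "\<dots> \<le> (8 * (M0 * R ^ 3 / \<epsilon>)) powr (1/3)"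
    proof (rule powr_mono2)
      have "4 * M0 / \<gamma> = 8 / 3 * (M0 * R ^ 3 / \<epsilon>)" by (simp add: \<gamma>_def)
      also have "\<dots> \<le> 8 * (M0 * R ^ 3 / \<epsilon>)" using M0 R_pos \<epsilon> by (intro mult_right_mono) auto
      finally show "4 * M0 / \<gamma> \<le> 8 * (M0 * R ^ 3 / \<epsilon>)" .
    qed (use M0 \<gamma> in auto)
    also have "\<dots> = 8 powr (1/3) * c"
      unfolding c_def by (rule powr_mult)
    also have "8 powr (1/3) = (2::real)"
      using powr_powr[of 2 3 "1/3::real"] by simp
    finally have "(4 * M0) powr (1/3) * \<Gamma> n powr (-1/3) \<le> 2 * c" .
    moreover have "6 * b * ln \<gamma> \<le> 6 * b * ln (\<Gamma> n)"
      using \<gamma> \<gamma>_le bW by (intro mult_left_mono ln_mono) auto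
    ultimately show ?thesis unfolding potential_def b_def[symmetric] by simp
  qed
  ultimately have "real n \<le> 36 * c + 6 * b * (ln \<Gamma>0 - ln \<gamma>)"
    by (simp add: right_diff_distrib)
  also have "6 * b * (ln \<Gamma>0 - ln \<gamma>) \<le> 6 * b * (20 * L)"
    using ln_le bW by (intro mult_left_mono) auto
  also have "\<dots> \<le> 6 * (3 * W) * (20 * L)"
    using bW L by (intro mult_right_mono mult_left_mono) auto
  finally have "real n \<le> 36 * c + 360 * (W * L)" by simp
  moreover have "1 \<le> 2 * (W * L)" using mult_mono[of 1 W "1/2" L] W L by simp
  moreover have "0 \<le> c" by (simp add: c_def)
  moreover have "0 \<le> W * L" using W L by simp
  ultimately have "real N \<le> 1000 * c + 1000 * (W * L)" using Suc by simp
  then show ?thesis by (simp only: c_def W_def L_def big_O_const_def mult.assoc)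
qed

lemma reaches_accuracy:
  assumes \<epsilon>: "0 < \<epsilon>"
  obtains N where "returns_at f g H x0 Mt0 (f xstar) \<epsilon> N"
proof -
  define C where "C = big_O_const * (M0 * R ^ 3 / \<epsilon>) powr (1/3)
    + big_O_const * (1 + sqrt M1 * R + R / \<rho>)
      * log_factor M0 M1 Mt0 R (norm (g x0)) \<epsilon> (R / \<rho>)"
  have "\<exists>k. gap k \<le> \<epsilon>"
  proof (rule ccontr)
    assume "\<not> (\<exists>k. gap k \<le> \<epsilon>)"
    then have "real N \<le> C" for N unfolding C_def by (intro iteration_bound[OF \<epsilon>]) (simp add: not_le)
    moreover obtain N where "C < real N" using reals_Archimedean2 by blast
    ultimately show False by (meson not_le)
  qed
  then have "gap (LEAST k. gap k \<le> \<epsilon>) \<le> \<epsilon>" by (rule LeastI_ex)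
  moreover have "\<epsilon> < gap k" if "k < (LEAST k. gap k \<le> \<epsilon>)" for k
    using not_less_Least[OF that] by simp
  ultimately show ?thesis
    by (intro that[of "LEAST k. gap k \<le> \<epsilon>"]) (auto simp: returns_at_def acr_iterate_def)
qed

lemma init_rejections_le:
  "int (init_rejections g H x0 Mt0) \<le> \<lceil>log 2 (max 1 (T0 / Mt0))\<rceil>"
proof (rule int_le_ceiling_log2)
  show "init_rejections g H x0 Mt0 = 0 \<or> 2 ^ init_rejections g H x0 Mt0 < 2 * (T0 / Mt0)"
    using init_rejections_bound Mt0 by (auto simp: Mt_def field_simps)
qed

end

section \<open>Complexity under the local and the global condition\<close>

lemma bounds_local:
  fixes f :: "'a::euclidean_space \<Rightarrow> real"
  assumes C2: "convex_C2 f g H"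
    and minimizer: "\<And>x. f xstar \<le> f x"
    and M0: "0 \<le> M0" and M1: "0 \<le> M1" and Mt0: "0 < Mt0"
    and R: "R = norm (x0 - xstar)"
    and \<rho>: "0 < \<rho>" and smooth: "local_gen_smooth g H M0 M1 \<rho>"
  shows "loops_terminate f g H x0 Mt0 \<and>
    int (init_rejections g H x0 Mt0)
      \<le> \<lceil>log 2 (max 1 (max (M0 + 2 * M1 * norm (g x0)) (2 * norm (g x0) / (15 * \<rho>\<^sup>2)) / Mt0))\<rceil> \<and>
    (\<forall>\<epsilon>>0. \<exists>N. returns_at f g H x0 Mt0 (f xstar) \<epsilon> N \<and>
      real N \<le> big_O_const * (M0 * R ^ 3 / \<epsilon>) powr (1/3)
        + big_O_const * (1 + sqrt M1 * R + R / \<rho>)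
            * log_factor M0 M1 Mt0 R (norm (g x0)) \<epsilon> (R / \<rho>) \<and>
      int (total_main_rejections f g H x0 Mt0 N)
        \<le> \<lceil>log 2 (max 1 (max (max (12 * sqrt 2 * M1 powr (3/2) * R ^ 3) (2 * R ^ 3 / (9 * \<rho> ^ 3)))
                          (4 * M0 * R ^ 3 / (3 * \<epsilon>))))\<rceil>)"
proof -
  interpret convex_C2 f g H by (rule C2)
  show ?thesis
  proof (cases "g x0 = 0")
    case True
    have nonneg: "0 \<le> \<lceil>log 2 (max 1 X)\<rceil>" for X :: real
      using int_le_ceiling_log2[of 0 X] by simp
    have "returns_at f g H x0 Mt0 (f xstar) \<epsilon> 0" if "0 < \<epsilon>" for \<epsilon>
      using gradient_ineq[of x0 xstar] True that
      by (simp add: returns_at_def acr_iterate_def init_state_def Let_def)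
    moreover have "0 \<le> big_O_const * (M0 * R ^ 3 / \<epsilon>) powr (1/3)
        + big_O_const * (1 + sqrt M1 * R + R / \<rho>)
            * log_factor M0 M1 Mt0 R (norm (g x0)) \<epsilon> (R / \<rho>)" if "0 < \<epsilon>" for \<epsilon>
    proof -
      have "0 \<le> R" by (simp add: R)
      then have "0 \<le> R / \<rho>" "0 \<le> sqrt M1 * R" using M1 \<rho> by auto
      moreover have "1 / 2 \<le> log_factor M0 M1 Mt0 R (norm (g x0)) \<epsilon> (R / \<rho>)"
        by (rule log_factor_ge) (use M0 M1 Mt0 \<open>0 \<le> R\<close> that \<open>0 \<le> R / \<rho>\<close> in auto)
      ultimately show ?thesis
        by (intro add_nonneg_nonneg mult_nonneg_nonneg) (auto simp: big_O_const_def \<open>0 \<le> R\<close> M1)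
    qed
    moreover have "int (total_main_rejections f g H x0 Mt0 0) \<le> \<lceil>log 2 (max 1 X)\<rceil>" for X :: real
      using nonneg[of X] by (simp add: total_main_rejections_def)
    moreover have "int (init_rejections g H x0 Mt0) \<le> \<lceil>log 2 (max 1 X)\<rceil>" for X :: real
      using nonneg[of X] True by (simp add: init_rejections_def)
    moreover have "loops_terminate f g H x0 Mt0" using True by (simp add: loops_terminate_def)
    ultimately show ?thesis by (metis of_nat_0)
  next
    case False
    interpret acr f g H x0 xstar M0 M1 Mt0 R \<rho>
      by unfold_locales (use minimizer M0 M1 Mt0 R \<rho> smooth False in auto)
    have "\<exists>N. returns_at f g H x0 Mt0 (f xstar) \<epsilon> N \<and>
      real N \<le> big_O_const * (M0 * R ^ 3 / \<epsilon>) powr (1/3)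
        + big_O_const * (1 + sqrt M1 * R + R / \<rho>)
            * log_factor M0 M1 Mt0 R (norm (g x0)) \<epsilon> (R / \<rho>) \<and>
      int (J N) \<le> \<lceil>log 2 (max 1 (max B (4 * M0 * R ^ 3 / (3 * \<epsilon>))))\<rceil>" if \<epsilon>: "0 < \<epsilon>" for \<epsilon>
    proof -
      obtain N where N: "returns_at f g H x0 Mt0 (f xstar) \<epsilon> N"
        using reaches_accuracy[OF \<epsilon>] .
      then have gap: "\<epsilon> < gap k" if "k < N" for k
        using that by (simp add: returns_at_def acr_iterate_def)
      from iteration_bound[OF \<epsilon> gap] int_le_ceiling_log2[OF total_rejections[OF \<epsilon> gap]] N
      show ?thesis by blast
    qed
    with loops_terminate init_rejections_le show ?thesis
      unfolding T0_def B_def by blast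
  qed
qed

lemma returns_at_unique:
  assumes "returns_at f g H x0 Mt0 fstar \<epsilon> N" "returns_at f g H x0 Mt0 fstar \<epsilon> N'"
  shows "N = N'"
  using assms unfolding returns_at_def by (meson linorder_neqE_nat not_le)

text \<open>
  A function that is globally smooth is locally smooth for every radius, and the global
  bound is the limit of the local ones as the radius tends to infinity.
\<close>
lemma iteration_bound_limit:
  fixes a b s :: real
  assumes nn: "0 \<le> M0" "0 \<le> M1" "0 < Mt0" "0 \<le> R" "0 \<le> G" "0 < \<epsilon>"
    and le: "\<And>\<rho>. 0 < \<rho> \<Longrightarrow> n \<le> a + b * (1 + s + R / \<rho>) * log_factor M0 M1 Mt0 R G \<epsilon> (R / \<rho>)"
  shows "n \<le> a + b * (1 + s) * log_factor M0 M1 Mt0 R G \<epsilon> 0"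
proof (rule tendsto_lowerbound)
  let ?S = "\<lambda>\<tau>. 2 + M0 * R ^ 3 / \<epsilon> + M1 * R\<^sup>2 + Mt0 * R ^ 3 / \<epsilon> + G * R / \<epsilon> + G / (Mt0 * R\<^sup>2) + \<tau>"
  have "?S 0 \<noteq> 0"
    using nn by (intro less_imp_neq[symmetric]) (simp add: add_pos_nonneg)
  moreover have "((\<lambda>\<rho>. R / \<rho>) \<longlongrightarrow> 0) at_top"
    by (rule tendsto_divide_0[OF tendsto_const])
      (rule filterlim_at_top_imp_at_infinity[OF filterlim_ident])
  ultimately have "((\<lambda>\<rho>. a + b * (1 + s + R / \<rho>) * ln (?S (R / \<rho>))) \<longlongrightarrow> a + b * (1 + s + 0) * ln (?S 0)) at_top"
    by (intro tendsto_intros)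
  then show "((\<lambda>\<rho>. a + b * (1 + s + R / \<rho>) * log_factor M0 M1 Mt0 R G \<epsilon> (R / \<rho>))
      \<longlongrightarrow> a + b * (1 + s) * log_factor M0 M1 Mt0 R G \<epsilon> 0) at_top"
    by (simp add: log_factor_def)
  show "\<forall>\<^sub>F \<rho> in at_top. n \<le> a + b * (1 + s + R / \<rho>) * log_factor M0 M1 Mt0 R G \<epsilon> (R / \<rho>)"
    using eventually_gt_at_top[of "0::real"] by eventually_elim (rule le)
qed simp

theorem theoremD16:
  fixes f :: "'a::euclidean_space \<Rightarrow> real"
    and g :: "'a \<Rightarrow> 'a"
    and H :: "'a \<Rightarrow> 'a \<Rightarrow>\<^sub>L 'a"
    and x0 xstar :: 'a
    and M0 M1 Mt0 R :: real
  assumes convex: "convex_on UNIV f"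
    and gradient: "\<And>x. GDERIV f x :> g x"
    and hessian: "\<And>x. (g has_derivative blinfun_apply (H x)) (at x)"
    and hessian_cont: "continuous_on UNIV H"
    and minimizer: "\<And>x. f xstar \<le> f x"
    and "0 \<le> M0" "0 \<le> M1" "0 < Mt0"
    and R: "R = norm (x0 - xstar)"
  shows
    "(global_gen_smooth g H M0 M1 \<longrightarrow>
        loops_terminate f g H x0 Mt0 \<and>
        int (init_rejections g H x0 Mt0)
          \<le> \<lceil>log 2 (max 1 ((M0 + 2 * M1 * norm (g x0)) / Mt0))\<rceil> \<and>
        (\<forall>\<epsilon>>0. \<exists>N. returns_at f g H x0 Mt0 (f xstar) \<epsilon> N \<and>
           real N \<le> big_O_const * (M0 * R ^ 3 / \<epsilon>) powr (1/3)
             + big_O_const * (1 + sqrt M1 * R) * log_factor M0 M1 Mt0 R (norm (g x0)) \<epsilon> 0 \<and>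
           int (total_main_rejections f g H x0 Mt0 N)
             \<le> \<lceil>log 2 (max 1 (max (12 * sqrt 2 * M1 powr (3/2) * R ^ 3)
                               (4 * M0 * R ^ 3 / (3 * \<epsilon>))))\<rceil>))
     \<and>
     (\<forall>\<rho>>0. local_gen_smooth g H M0 M1 \<rho> \<longrightarrow>
        loops_terminate f g H x0 Mt0 \<and>
        int (init_rejections g H x0 Mt0)
          \<le> \<lceil>log 2 (max 1 (max (M0 + 2 * M1 * norm (g x0))
                             (2 * norm (g x0) / (15 * \<rho>\<^sup>2)) / Mt0))\<rceil> \<and>
        (\<forall>\<epsilon>>0. \<exists>N. returns_at f g H x0 Mt0 (f xstar) \<epsilon> N \<and>
           real N \<le> big_O_const * (M0 * R ^ 3 / \<epsilon>) powr (1/3)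
             + big_O_const * (1 + sqrt M1 * R + R / \<rho>)
                 * log_factor M0 M1 Mt0 R (norm (g x0)) \<epsilon> (R / \<rho>) \<and>
           int (total_main_rejections f g H x0 Mt0 N)
             \<le> \<lceil>log 2 (max 1 (max (max (12 * sqrt 2 * M1 powr (3/2) * R ^ 3)
                                    (2 * R ^ 3 / (9 * \<rho> ^ 3)))
                               (4 * M0 * R ^ 3 / (3 * \<epsilon>))))\<rceil>))"
proof -
  have C2: "convex_C2 f g H"
    by (intro convex_C2.intro convex gradient hessian hessian_cont)
  note M = \<open>0 \<le> M0\<close> \<open>0 \<le> M1\<close> \<open>0 < Mt0\<close>
  note local = bounds_local[OF C2 minimizer M R]
  have R0: "0 \<le> R" by (simp add: R)
  let ?G = "norm (g x0)"
  have smooth: "local_gen_smooth g H M0 M1 \<rho>" if "global_gen_smooth g H M0 M1" for \<rho>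
    using that by (simp add: global_gen_smooth_def local_gen_smooth_def)
  have terminate: "loops_terminate f g H x0 Mt0" if "global_gen_smooth g H M0 M1"
    using local[OF zero_less_one smooth[OF that]] by blast
  have init: "int (init_rejections g H x0 Mt0) \<le> \<lceil>log 2 (max 1 ((M0 + 2 * M1 * ?G) / Mt0))\<rceil>"
    if "global_gen_smooth g H M0 M1"
  proof -
    \<comment> \<open>For a radius this large, the term with \<open>\<rho>\<close> does not affect the maximum.\<close>
    define \<rho> where "\<rho> = max 1 (2 * ?G / (15 * Mt0))"
    have \<rho>: "1 \<le> \<rho>" "2 * ?G / (15 * Mt0) \<le> \<rho>" by (auto simp: \<rho>_def)
    have "2 * ?G / (15 * Mt0) \<le> \<rho>\<^sup>2"
      using \<rho> self_le_power[of \<rho> 2] by simp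
    then have small: "2 * ?G / (15 * \<rho>\<^sup>2) \<le> Mt0"
      using \<rho> M by (simp add: field_simps)
    have drop: "max 1 (max (M0 + 2 * M1 * ?G) (2 * ?G / (15 * \<rho>\<^sup>2)) / Mt0)
        = max 1 ((M0 + 2 * M1 * ?G) / Mt0)"
      using divide_right_mono[OF small, of Mt0] M by (simp add: max_divide_distrib_right)
    have "0 < \<rho>" using \<rho> by simp
    from local[OF this smooth[OF that]] show ?thesis unfolding drop by blast
  qed
  have main: "\<exists>N. returns_at f g H x0 Mt0 (f xstar) \<epsilon> N \<and>
           real N \<le> big_O_const * (M0 * R ^ 3 / \<epsilon>) powr (1/3)
             + big_O_const * (1 + sqrt M1 * R) * log_factor M0 M1 Mt0 R ?G \<epsilon> 0 \<and>
           int (total_main_rejections f g H x0 Mt0 N)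
             \<le> \<lceil>log 2 (max 1 (max (12 * sqrt 2 * M1 powr (3/2) * R ^ 3)
                               (4 * M0 * R ^ 3 / (3 * \<epsilon>))))\<rceil>"
    if glob: "global_gen_smooth g H M0 M1" and \<epsilon>: "0 < \<epsilon>" for \<epsilon>
  proof -
    \<comment> \<open>Again the term with \<open>\<rho>\<close> is absorbed, here by the 1 inside the maximum.\<close>
    define \<rho> where "\<rho> = max 1 R"
    have \<rho>: "0 < \<rho>" "R \<le> \<rho>" by (auto simp: \<rho>_def)
    have "R ^ 3 \<le> \<rho> ^ 3" using \<rho> R0 by (intro power_mono) auto
    then have "2 * R ^ 3 \<le> 9 * \<rho> ^ 3" using zero_le_power[OF R0, of 3] by linarith
    then have "2 * R ^ 3 / (9 * \<rho> ^ 3) \<le> 1" using \<rho> by (simp add: divide_le_eq)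
    then have drop: "max 1 (max (max x (2 * R ^ 3 / (9 * \<rho> ^ 3))) y) = max 1 (max x y)" for x y
      by (auto simp: max_def)
    obtain N where N: "returns_at f g H x0 Mt0 (f xstar) \<epsilon> N"
      "int (total_main_rejections f g H x0 Mt0 N)
        \<le> \<lceil>log 2 (max 1 (max (12 * sqrt 2 * M1 powr (3/2) * R ^ 3) (4 * M0 * R ^ 3 / (3 * \<epsilon>))))\<rceil>"
      using local[OF \<rho>(1) smooth[OF glob]] \<epsilon> unfolding drop by blast
    have "real N \<le> big_O_const * (M0 * R ^ 3 / \<epsilon>) powr (1/3)
        + big_O_const * (1 + sqrt M1 * R + R / r) * log_factor M0 M1 Mt0 R ?G \<epsilon> (R / r)"
      if "0 < r" for r
      using local[OF that smooth[OF glob]] \<epsilon> returns_at_unique[OF N(1)] by blast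
    then have "real N \<le> big_O_const * (M0 * R ^ 3 / \<epsilon>) powr (1/3)
        + big_O_const * (1 + sqrt M1 * R) * log_factor M0 M1 Mt0 R ?G \<epsilon> 0"
      by (intro iteration_bound_limit) (use M R0 \<epsilon> in auto)
    with N show ?thesis by blast
  qed
  show ?thesis
    using terminate init main local by blast
qed

end
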